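(* Let $2\le n\le\infty$, let $(G_i)_{i}$ be a family of countable groups indexed by $1\le i\le n$ (by all integers $i\geq 1$ if $n=\infty$), and let $G=*_{i=1}^n G_i$ be their free product. Then either $G\in\mathcal{A}$ or $G$ has virtually (F), and these alternatives are mutually exclusive. Moreover, $G$ has virtually (F) if and only if $n\neq\infty$ and, upon possibly reordering the factors, all $G_i$ with $i>1$ have property (F) and $G_1$ has virtually (F).
   Context: "Countable" always means of cardinality $\aleph_0$ (in particular infinite). An action of a group $G$ on a set $X$ is called amenable if there is an invariant mean on $X$, i.e. a $G$-invariant map $\mu$ from the collection of all subsets of $X$ to $[0,1]$ such that $\mu(A\cup B)=\mu(A)+\mu(B)$ whenever $A\cap B=\varnothing$, and $\mu(X)=1$. The class $\mathcal{A}$ is the class of all countable groups $G$ that admit a faithful transitive amenable action on some set. A countable group $G$ has the fixed point property (F) if every amenable $G$-action on a countable set has a fixed point (a point fixed by all of $G$). A countable group has virtually (F) if it has a finite index subgroup (possibly the group itself) with property (F). *)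

theory Defs
  imports Complex_Main "HOL-Algebra.Group_Action" "HOL-Library.Extended_Nat" "HOL-Library.Countable_Set"
begin

text \<open>Countable means of cardinality aleph-zero, for groups and for the sets acted upon.\<close>

definition countably_infinite :: "'a set \<Rightarrow> bool" where
  "countably_infinite S \<longleftrightarrow> countable S \<and> infinite S"

definition countable_group :: "('a, 'm) monoid_scheme \<Rightarrow> bool" where
  "countable_group G \<longleftrightarrow> group G \<and> countably_infinite (carrier G)"


section \<open>Amenable actions\<close>

text \<open>A mean is defined on all subsets of \<open>X\<close> and is only finitely additive; its values
  outside the power set of \<open>X\<close> are irrelevant.\<close>

definition invariant_mean ::
  "('a, 'm) monoid_scheme \<Rightarrow> 'x set \<Rightarrow> ('a \<Rightarrow> 'x \<Rightarrow> 'x) \<Rightarrow> ('x set \<Rightarrow> real) \<Rightarrow> bool" where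
  "invariant_mean G X \<phi> m \<longleftrightarrow>
     (\<forall>A. A \<subseteq> X \<longrightarrow> 0 \<le> m A \<and> m A \<le> 1) \<and>
     (\<forall>A B. A \<subseteq> X \<longrightarrow> B \<subseteq> X \<longrightarrow> A \<inter> B = {} \<longrightarrow> m (A \<union> B) = m A + m B) \<and>
     m X = 1 \<and>
     (\<forall>g \<in> carrier G. \<forall>A. A \<subseteq> X \<longrightarrow> m (\<phi> g ` A) = m A)"

definition amenable_action ::
  "('a, 'm) monoid_scheme \<Rightarrow> 'x set \<Rightarrow> ('a \<Rightarrow> 'x \<Rightarrow> 'x) \<Rightarrow> bool" where
  "amenable_action G X \<phi> \<longleftrightarrow> group_action G X \<phi> \<and> (\<exists>m. invariant_mean G X \<phi> m)"

definition has_fixed_point ::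
  "('a, 'm) monoid_scheme \<Rightarrow> 'x set \<Rightarrow> ('a \<Rightarrow> 'x \<Rightarrow> 'x) \<Rightarrow> bool" where
  "has_fixed_point G X \<phi> \<longleftrightarrow> (\<exists>x \<in> X. \<forall>g \<in> carrier G. \<phi> g x = x)"

text \<open>A definition cannot quantify over the type of the set acted upon, so the next two let
  it range over sets of natural numbers.  Nothing is lost: a transitive action of a countable
  group lives on a countable (possibly finite) set, and actions can be transported along
  bijections.  The lemmas \<open>class_A_I\<close> and \<open>property_F_D\<close> below state this for sets of
  arbitrary type.\<close>

definition class_A :: "('a, 'm) monoid_scheme \<Rightarrow> bool" where
  "class_A G \<longleftrightarrow> countable_group G \<and>
     (\<exists>(X :: nat set) \<phi>. faithful_action G X \<phi> \<and> transitive_action G X \<phi> \<and> amenable_action G X \<phi>)"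

definition property_F :: "('a, 'm) monoid_scheme \<Rightarrow> bool" where
  "property_F G \<longleftrightarrow> countable_group G \<and>
     (\<forall>(X :: nat set) \<phi>. countably_infinite X \<longrightarrow> amenable_action G X \<phi> \<longrightarrow> has_fixed_point G X \<phi>)"

definition virtually_F :: "('a, 'm) monoid_scheme \<Rightarrow> bool" where
  "virtually_F G \<longleftrightarrow> countable_group G \<and>
     (\<exists>H. subgroup H G \<and> finite (rcosets\<^bsub>G\<^esub> H) \<and> property_F (G\<lparr>carrier := H\<rparr>))"


subsection \<open>Independence of the type of the set acted upon\<close>

definition transport_action :: "'x set \<Rightarrow> ('x \<Rightarrow> 'y) \<Rightarrow> ('a \<Rightarrow> 'x \<Rightarrow> 'x) \<Rightarrow> 'a \<Rightarrow> 'y \<Rightarrow> 'y" where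
  "transport_action X f \<phi> = (\<lambda>g. \<lambda>y \<in> f ` X. f (\<phi> g (inv_into X f y)))"

context
  fixes G (structure) and X :: "'x set" and \<phi> and f :: "'x \<Rightarrow> 'y"
  assumes act: "group_action G X \<phi>" and inj: "inj_on f X"
begin

interpretation group_action G X \<phi> by (rule act)

lemma transport_action_apply:
  "x \<in> X \<Longrightarrow> transport_action X f \<phi> g (f x) = f (\<phi> g x)"
  using inj by (simp add: transport_action_def)

lemma transport_group_action: "group_action G (f ` X) (transport_action X f \<phi>)"
proof -
  let ?\<psi> = "transport_action X f \<phi>"
  have grp: "group G" using group_hom group_hom.axioms(1) by blast
  have cl: "\<phi> g x \<in> X" if "g \<in> carrier G" "x \<in> X" for g x
    using element_image[OF that] by simp
  have Bij: "?\<psi> g \<in> Bij (f ` X)" if g: "g \<in> carrier G" for g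
  proof -
    have "inj_on (?\<psi> g) (f ` X)"
    proof (rule inj_onI)
      fix y z assume "y \<in> f ` X" "z \<in> f ` X" and eq: "?\<psi> g y = ?\<psi> g z"
      then obtain a b where ab: "a \<in> X" "b \<in> X" "y = f a" "z = f b" by auto
      then have "f (\<phi> g a) = f (\<phi> g b)" using eq by (simp add: transport_action_apply)
      then have "\<phi> g a = \<phi> g b" using inj cl[OF g] ab by (auto dest: inj_onD)
      then show "y = z" using inj_prop[OF g] ab by (auto dest: inj_onD)
    qed
    moreover have "?\<psi> g ` f ` X = f ` (\<phi> g ` X)"
      unfolding image_image by (intro image_cong) (auto simp: transport_action_apply)
    ultimately show ?thesis
      using surj_prop[OF g] by (auto simp: Bij_def bij_betw_def transport_action_def)
  qed
  have "?\<psi> (g \<otimes> h) = compose (f ` X) (?\<psi> g) (?\<psi> h)"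
    if "g \<in> carrier G" "h \<in> carrier G" for g h
  proof (rule extensionalityI[of _ "f ` X"])
    show "?\<psi> (g \<otimes> h) y = compose (f ` X) (?\<psi> g) (?\<psi> h) y" if "y \<in> f ` X" for y
      using that \<open>g \<in> _\<close> \<open>h \<in> _\<close>
      by (auto simp: compose_eq transport_action_apply composition_rule cl)
  qed (auto simp: transport_action_def)
  then have "?\<psi> \<in> hom G (BijGroup (f ` X))"
    using Bij by (auto simp: hom_def BijGroup_def)
  then show ?thesis
    by (simp add: group_action_def group_hom_def group_hom_axioms_def grp group_BijGroup)
qed

lemma transport_amenable_action:
  assumes "amenable_action G X \<phi>"
  shows "amenable_action G (f ` X) (transport_action X f \<phi>)"
proof -
  obtain m where m: "invariant_mean G X \<phi> m"
    using assms by (auto simp: amenable_action_def)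
  let ?\<nu> = "\<lambda>B. m (X \<inter> f -` B)"
  have "?\<nu> (A \<union> B) = ?\<nu> A + ?\<nu> B" if "A \<inter> B = {}" for A B
  proof -
    have "X \<inter> f -` (A \<union> B) = (X \<inter> f -` A) \<union> (X \<inter> f -` B)" by auto
    moreover have "(X \<inter> f -` A) \<inter> (X \<inter> f -` B) = {}" using that by auto
    ultimately show ?thesis using m by (simp add: invariant_mean_def)
  qed
  moreover have "X \<inter> f -` f ` X = X" by auto
  moreover have "?\<nu> (transport_action X f \<phi> g ` B) = ?\<nu> B"
    if g: "g \<in> carrier G" and B: "B \<subseteq> f ` X" for g B
  proof -
    obtain A where A: "A \<subseteq> X" "B = f ` A" using B by (meson subset_imageE)
    have "\<phi> g ` A \<subseteq> X" using surj_prop[OF g] A by auto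
    have "transport_action X f \<phi> g ` B = f ` (\<phi> g ` A)"
      unfolding A(2) image_image using A(1) by (intro image_cong) (auto simp: transport_action_apply)
    moreover have "X \<inter> f -` f ` C = C" if "C \<subseteq> X" for C
      using that inj by (auto simp: inj_on_def)
    ultimately show ?thesis
      using m g A \<open>\<phi> g ` A \<subseteq> X\<close> by (simp add: invariant_mean_def)
  qed
  ultimately have "invariant_mean G (f ` X) (transport_action X f \<phi>) ?\<nu>"
    using m by (auto simp: invariant_mean_def)
  then show ?thesis
    using transport_group_action by (auto simp: amenable_action_def)
qed

lemma transport_has_fixed_point:
  assumes "has_fixed_point G (f ` X) (transport_action X f \<phi>)"
  shows "has_fixed_point G X \<phi>"
proof -
  obtain x where x: "x \<in> X" "\<forall>g\<in>carrier G. f (\<phi> g x) = f x"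
    using assms by (auto simp: has_fixed_point_def transport_action_apply)
  then have "\<forall>g\<in>carrier G. \<phi> g x = x"
    using inj element_image[OF _ x(1)] by (auto dest: inj_onD)
  with x show ?thesis by (auto simp: has_fixed_point_def)
qed

lemma transport_transitive_action:
  assumes "transitive_action G X \<phi>"
  shows "transitive_action G (f ` X) (transport_action X f \<phi>)"
proof (intro transitive_action.intro transport_group_action transitive_action_axioms.intro)
  fix x y assume "x \<in> f ` X" "y \<in> f ` X"
  then show "\<exists>g\<in>carrier G. transport_action X f \<phi> g x = y"
    using transitive_action.unique_orbit[OF assms] by (fastforce simp: transport_action_apply)
qed

lemma transport_faithful_action:
  assumes "faithful_action G X \<phi>"
  shows "faithful_action G (f ` X) (transport_action X f \<phi>)"
proof (intro faithful_action.intro transport_group_action faithful_action_axioms.intro inj_onI)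
  fix g h
  assume g: "g \<in> carrier G" and h: "h \<in> carrier G"
    and eq: "transport_action X f \<phi> g = transport_action X f \<phi> h"
  have "\<phi> g x = \<phi> h x" if x: "x \<in> X" for x
  proof -
    have "f (\<phi> g x) = f (\<phi> h x)"
      using fun_cong[OF eq, of "f x"] x by (simp add: transport_action_apply)
    then show ?thesis
      using inj element_image[OF g x] element_image[OF h x] by (auto dest: inj_onD)
  qed
  moreover have "\<phi> g \<in> extensional X" "\<phi> h \<in> extensional X"
    using bij_prop0 g h by (auto simp: Bij_def)
  ultimately have "\<phi> g = \<phi> h" by (intro extensionalityI)
  then show "g = h"
    using faithful_action.faithful[OF assms] g h by (auto dest: inj_onD)
qed

end

lemma property_F_D:
  fixes X :: "'x set"
  assumes "property_F G" "countably_infinite X" "amenable_action G X \<phi>"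
  shows "has_fixed_point G X \<phi>"
proof -
  have inj: "inj_on (to_nat_on X) X" and act: "group_action G X \<phi>"
    using assms by (auto simp: countably_infinite_def amenable_action_def)
  have "countably_infinite (to_nat_on X ` X)"
    using assms inj by (auto simp: countably_infinite_def finite_image_iff)
  then show ?thesis
    using transport_has_fixed_point[OF act inj] transport_amenable_action[OF act inj] assms
    by (auto simp: property_F_def)
qed

lemma class_A_I:
  fixes X :: "'x set"
  assumes G: "countable_group G" and F: "faithful_action G X \<phi>"
    and T: "transitive_action G X \<phi>" and A: "amenable_action G X \<phi>"
  shows "class_A G"
proof -
  have act: "group_action G X \<phi>" using A by (simp add: amenable_action_def)
  have "countable X"
  proof (cases "X = {}")
    case False
    then obtain x where x: "x \<in> X" by auto
    have "X \<subseteq> (\<lambda>g. \<phi> g x) ` carrier G"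
      using transitive_action.unique_orbit[OF T x] by force
    then show ?thesis
      using G by (meson countable_group_def countably_infinite_def countable_image countable_subset)
  qed auto
  then have inj: "inj_on (to_nat_on X) X" by (rule inj_on_to_nat_on)
  show ?thesis
    unfolding class_A_def
    using G transport_faithful_action[OF act inj F] transport_transitive_action[OF act inj T]
      transport_amenable_action[OF act inj A] by blast
qed


section \<open>Free products\<close>

text \<open>The free product of a family of groups, as the monoid of words in the disjoint union of
  the factors modulo the congruence generated by deleting identity letters and by multiplying
  adjacent letters from the same factor.\<close>

definition fp_words :: "'i set \<Rightarrow> ('i \<Rightarrow> ('a, 'm) monoid_scheme) \<Rightarrow> ('i \<times> 'a) list set" where
  "fp_words I G = lists (SIGMA i:I. carrier (G i))"

inductive_set fp_rel ::
  "'i set \<Rightarrow> ('i \<Rightarrow> ('a, 'm) monoid_scheme) \<Rightarrow> (('i \<times> 'a) list \<times> ('i \<times> 'a) list) set"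
  for I :: "'i set" and G :: "'i \<Rightarrow> ('a, 'm) monoid_scheme" where
  unit: "\<lbrakk>u \<in> fp_words I G; v \<in> fp_words I G; i \<in> I\<rbrakk>
         \<Longrightarrow> (u @ [(i, \<one>\<^bsub>G i\<^esub>)] @ v, u @ v) \<in> fp_rel I G"
| mult: "\<lbrakk>u \<in> fp_words I G; v \<in> fp_words I G; i \<in> I; x \<in> carrier (G i); y \<in> carrier (G i)\<rbrakk>
         \<Longrightarrow> (u @ [(i, x), (i, y)] @ v, u @ [(i, x \<otimes>\<^bsub>G i\<^esub> y)] @ v) \<in> fp_rel I G"
| refl: "u \<in> fp_words I G \<Longrightarrow> (u, u) \<in> fp_rel I G"
| sym: "(u, v) \<in> fp_rel I G \<Longrightarrow> (v, u) \<in> fp_rel I G"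
| trans: "\<lbrakk>(u, v) \<in> fp_rel I G; (v, w) \<in> fp_rel I G\<rbrakk> \<Longrightarrow> (u, w) \<in> fp_rel I G"

definition free_product ::
  "'i set \<Rightarrow> ('i \<Rightarrow> ('a, 'm) monoid_scheme) \<Rightarrow> ('i \<times> 'a) list set monoid" where
  "free_product I G =
     \<lparr>carrier = fp_words I G // fp_rel I G,
      mult = (\<lambda>A B. \<Union>u\<in>A. \<Union>v\<in>B. fp_rel I G `` {u @ v}),
      one = fp_rel I G `` {[]}\<rparr>"

definition fp_inj ::
  "'i set \<Rightarrow> ('i \<Rightarrow> ('a, 'm) monoid_scheme) \<Rightarrow> 'i \<Rightarrow> 'a \<Rightarrow> ('i \<times> 'a) list set" where
  "fp_inj I G i x = fp_rel I G `` {[(i, x)]}"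

lemma fp_words_Cons [simp]:
  "p # w \<in> fp_words I G \<longleftrightarrow> fst p \<in> I \<and> snd p \<in> carrier (G (fst p)) \<and> w \<in> fp_words I G"
  by (cases p) (auto simp: fp_words_def)

lemma fp_words_append [simp]:
  "[] \<in> fp_words I G"
  "u @ v \<in> fp_words I G \<longleftrightarrow> u \<in> fp_words I G \<and> v \<in> fp_words I G"
  by (auto simp: fp_words_def)

context
  fixes I :: "'i set" and G :: "'i \<Rightarrow> ('a, 'm) monoid_scheme"
  assumes grp: "\<And>i. i \<in> I \<Longrightarrow> group (G i)"
begin

lemma fp_rel_words:
  "(u, v) \<in> fp_rel I G \<Longrightarrow> u \<in> fp_words I G \<and> v \<in> fp_words I G"
  by (induction rule: fp_rel.induct)
    (auto intro: monoid.m_closed monoid.one_closed group.is_monoid[OF grp])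

lemma fp_rel_append_left:
  "\<lbrakk>(u, v) \<in> fp_rel I G; w \<in> fp_words I G\<rbrakk> \<Longrightarrow> (w @ u, w @ v) \<in> fp_rel I G"
proof (induction rule: fp_rel.induct)
  case (unit u v i)
  then show ?case using fp_rel.unit[of "w @ u" I G v i] by simp
next
  case (mult u v i x y)
  then show ?case using fp_rel.mult[of "w @ u" I G v i x y] by simp
next
  case (trans u v w')
  then show ?case by (meson fp_rel.trans)
qed (auto intro: fp_rel.refl fp_rel.sym)

lemma fp_rel_append_right:
  "\<lbrakk>(u, v) \<in> fp_rel I G; w \<in> fp_words I G\<rbrakk> \<Longrightarrow> (u @ w, v @ w) \<in> fp_rel I G"
proof (induction rule: fp_rel.induct)
  case (unit u v i)
  then show ?case using fp_rel.unit[of u I G "v @ w" i] by simp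
next
  case (mult u v i x y)
  then show ?case using fp_rel.mult[of u I G "v @ w" i x y] by simp
next
  case (trans u v w')
  then show ?case by (meson fp_rel.trans)
qed (auto intro: fp_rel.refl fp_rel.sym)

lemma fp_rel_equiv: "equiv (fp_words I G) (fp_rel I G)"
  by (rule equivI)
    (auto intro!: refl_onI symI transI dest: fp_rel_words
      intro: fp_rel.refl fp_rel.sym fp_rel.trans)

lemma fp_class_eq: "(u, v) \<in> fp_rel I G \<Longrightarrow> fp_rel I G `` {u} = fp_rel I G `` {v}"
  by (rule equiv_class_eq[OF fp_rel_equiv])

lemma fp_mult:
  assumes "u \<in> fp_words I G" "v \<in> fp_words I G"
  shows "fp_rel I G `` {u} \<otimes>\<^bsub>free_product I G\<^esub> fp_rel I G `` {v} = fp_rel I G `` {u @ v}"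
proof -
  have "fp_rel I G `` {u' @ v'} = fp_rel I G `` {u @ v}"
    if "(u, u') \<in> fp_rel I G" "(v, v') \<in> fp_rel I G" for u' v'
  proof -
    have "(u @ v, u' @ v) \<in> fp_rel I G" by (rule fp_rel_append_right) fact+
    moreover have "(u' @ v, u' @ v') \<in> fp_rel I G"
      using that fp_rel_words by (blast intro: fp_rel_append_left)
    ultimately show ?thesis by (metis fp_class_eq)
  qed
  moreover have "(u, u) \<in> fp_rel I G" "(v, v) \<in> fp_rel I G"
    using assms by (auto intro: fp_rel.refl)
  ultimately have "(\<Union>u'\<in>fp_rel I G `` {u}. \<Union>v'\<in>fp_rel I G `` {v}. fp_rel I G `` {u' @ v'})
      = fp_rel I G `` {u @ v}"
    by blast
  then show ?thesis by (simp add: free_product_def)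
qed

lemma fp_carrier_cases:
  assumes "A \<in> carrier (free_product I G)"
  obtains u where "u \<in> fp_words I G" "A = fp_rel I G `` {u}"
  using assms by (auto simp: free_product_def elim: quotientE)

lemma fp_class_closed: "u \<in> fp_words I G \<Longrightarrow> fp_rel I G `` {u} \<in> carrier (free_product I G)"
  by (simp add: free_product_def quotientI)

lemma fp_one: "\<one>\<^bsub>free_product I G\<^esub> = fp_rel I G `` {[]}"
  by (simp add: free_product_def)

lemma fp_left_inverse:
  "u \<in> fp_words I G \<Longrightarrow> \<exists>v \<in> fp_words I G. (v @ u, []) \<in> fp_rel I G"
proof (induction u)
  case Nil
  then show ?case by (auto intro!: bexI[of _ "[]"] fp_rel.refl)
next
  case (Cons p u)
  obtain i x where p: "p = (i, x)" by (cases p)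
  then have ix: "i \<in> I" "x \<in> carrier (G i)" and u: "u \<in> fp_words I G" using Cons by auto
  interpret group "G i" using grp ix by simp
  obtain v where v: "v \<in> fp_words I G" "(v @ u, []) \<in> fp_rel I G" using Cons u by blast
  let ?y = "inv\<^bsub>G i\<^esub> x"
  have "((v @ [(i, ?y)]) @ p # u, v @ [(i, ?y \<otimes>\<^bsub>G i\<^esub> x)] @ u) \<in> fp_rel I G"
    using fp_rel.mult[of v I G u i ?y x] v u ix p by simp
  moreover have "(v @ [(i, ?y \<otimes>\<^bsub>G i\<^esub> x)] @ u, v @ u) \<in> fp_rel I G"
    using fp_rel.unit[of v I G u i] v u ix by simp
  ultimately have "((v @ [(i, ?y)]) @ p # u, []) \<in> fp_rel I G"
    using v(2) by (meson fp_rel.trans)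
  moreover have "v @ [(i, ?y)] \<in> fp_words I G" using v ix by simp
  ultimately show ?case by blast
qed

theorem free_product_group: "group (free_product I G)"
proof (rule groupI)
  fix A assume "A \<in> carrier (free_product I G)"
  then obtain u where u: "u \<in> fp_words I G" "A = fp_rel I G `` {u}" by (rule fp_carrier_cases)
  obtain v where v: "v \<in> fp_words I G" "(v @ u, []) \<in> fp_rel I G" using fp_left_inverse u by blast
  have "fp_rel I G `` {v} \<otimes>\<^bsub>free_product I G\<^esub> A = \<one>\<^bsub>free_product I G\<^esub>"
    using u v by (simp add: fp_mult fp_one fp_class_eq)
  then show "\<exists>B\<in>carrier (free_product I G). B \<otimes>\<^bsub>free_product I G\<^esub> A = \<one>\<^bsub>free_product I G\<^esub>"
    using fp_class_closed v by blast
qed (auto elim!: fp_carrier_cases simp: fp_mult fp_one fp_class_closed)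

lemma fp_inj_hom: "i \<in> I \<Longrightarrow> fp_inj I G i \<in> hom (G i) (free_product I G)"
  using fp_class_eq[OF fp_rel.mult[of "[]" I G "[]" i]]
  by (intro homI) (simp_all add: fp_inj_def fp_mult fp_class_closed)

text \<open>The universal property; with \<open>fp_inj_hom\<close> it characterises the free product.\<close>

theorem free_product_universal:
  assumes K: "group K" and h: "\<And>i. i \<in> I \<Longrightarrow> h i \<in> hom (G i) K"
  shows "\<exists>f \<in> hom (free_product I G) K. \<forall>i\<in>I. \<forall>x\<in>carrier (G i). f (fp_inj I G i x) = h i x"
    and "\<lbrakk>f \<in> hom (free_product I G) K; f' \<in> hom (free_product I G) K;
          \<forall>i\<in>I. \<forall>x\<in>carrier (G i). f (fp_inj I G i x) = h i x;
          \<forall>i\<in>I. \<forall>x\<in>carrier (G i). f' (fp_inj I G i x) = h i x;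
          A \<in> carrier (free_product I G)\<rbrakk> \<Longrightarrow> f A = f' A"
proof -
  interpret K: group K by (rule K)
  define e where "e = (\<lambda>w. foldr (\<lambda>p k. h (fst p) (snd p) \<otimes>\<^bsub>K\<^esub> k) w \<one>\<^bsub>K\<^esub>)"
  have hc: "h i x \<in> carrier K" if "i \<in> I" "x \<in> carrier (G i)" for i x
    using h that by (auto simp: hom_def)
  have ec: "e w \<in> carrier K" if "w \<in> fp_words I G" for w
    using that by (induction w) (auto simp: e_def hc)
  have app: "e (u @ v) = e u \<otimes>\<^bsub>K\<^esub> e v" if "u \<in> fp_words I G" "v \<in> fp_words I G" for u v
    using that(1)
  proof (induction u)
    case Nil then show ?case using ec that(2) by (simp add: e_def)
  next
    case (Cons p u)
    then show ?case using ec[of u] ec[of v] that(2) hc by (simp add: e_def K.m_assoc)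
  qed
  have single: "e [(i, x)] = h i x" if "i \<in> I" "x \<in> carrier (G i)" for i x
    using hc that by (simp add: e_def)
  have rel: "e u = e v" if "(u, v) \<in> fp_rel I G" for u v
    using that
  proof (induction rule: fp_rel.induct)
    case (unit u v i)
    interpret group_hom "G i" K "h i"
      using unit grp h K by (simp add: group_hom_def group_hom_axioms_def)
    have "e ([(i, \<one>\<^bsub>G i\<^esub>)] @ v) = e v"
      using unit ec[of v] by (simp add: e_def)
    then show ?case using unit app[of u "[(i, \<one>\<^bsub>G i\<^esub>)] @ v"] app[of u v] by simp
  next
    case (mult u v i x y)
    interpret group_hom "G i" K "h i"
      using mult grp h K by (simp add: group_hom_def group_hom_axioms_def)
    have "e ([(i, x), (i, y)] @ v) = e ([(i, x \<otimes>\<^bsub>G i\<^esub> y)] @ v)"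
      using mult ec[of v] by (simp add: e_def K.m_assoc)
    then show ?case
      using mult app[of u "[(i, x), (i, y)] @ v"] app[of u "[(i, x \<otimes>\<^bsub>G i\<^esub> y)] @ v"] by simp
  qed auto
  define F where "F = (\<lambda>A. e (SOME u. u \<in> A))"
  have F: "F (fp_rel I G `` {u}) = e u" if "u \<in> fp_words I G" for u
  proof -
    have "u \<in> fp_rel I G `` {u}" using that by (auto intro: fp_rel.refl)
    then have "(SOME u'. u' \<in> fp_rel I G `` {u}) \<in> fp_rel I G `` {u}" by (rule someI)
    then show ?thesis using rel by (auto simp: F_def)
  qed
  have "F \<in> hom (free_product I G) K"
    by (rule homI) (auto elim!: fp_carrier_cases simp: fp_mult F ec app)
  moreover have "\<forall>i\<in>I. \<forall>x\<in>carrier (G i). F (fp_inj I G i x) = h i x"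
    by (auto simp: fp_inj_def F single)
  ultimately show "\<exists>f \<in> hom (free_product I G) K.
      \<forall>i\<in>I. \<forall>x\<in>carrier (G i). f (fp_inj I G i x) = h i x" by blast
  have det: "f (fp_rel I G `` {w}) = e w"
    if f: "f \<in> hom (free_product I G) K"
      and fi: "\<forall>i\<in>I. \<forall>x\<in>carrier (G i). f (fp_inj I G i x) = h i x"
      and w: "w \<in> fp_words I G" for f w
    using w
  proof (induction w)
    case Nil
    have "f \<one>\<^bsub>free_product I G\<^esub> = \<one>\<^bsub>K\<^esub>"
      using f free_product_group K by (rule hom_one)
    then show ?case by (simp add: fp_one e_def)
  next
    case (Cons p w)
    obtain i x where p: "p = (i, x)" by (cases p)
    then have ix: "i \<in> I" "x \<in> carrier (G i)" and w: "w \<in> fp_words I G" using Cons by auto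
    have "fp_rel I G `` {p # w} = fp_inj I G i x \<otimes>\<^bsub>free_product I G\<^esub> fp_rel I G `` {w}"
      using ix w p by (simp add: fp_inj_def fp_mult)
    then have "f (fp_rel I G `` {p # w}) = f (fp_inj I G i x) \<otimes>\<^bsub>K\<^esub> f (fp_rel I G `` {w})"
      using hom_mult[OF f] fp_class_closed ix w by (simp add: fp_inj_def)
    then show ?case using Cons.IH[OF w] fi ix p by (simp add: e_def)
  qed
  show "f A = f' A"
    if f: "f \<in> hom (free_product I G) K" "f' \<in> hom (free_product I G) K"
      "\<forall>i\<in>I. \<forall>x\<in>carrier (G i). f (fp_inj I G i x) = h i x"
      "\<forall>i\<in>I. \<forall>x\<in>carrier (G i). f' (fp_inj I G i x) = h i x"
    and A: "A \<in> carrier (free_product I G)"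
  proof -
    obtain w where "w \<in> fp_words I G" "A = fp_rel I G `` {w}"
      using A by (rule fp_carrier_cases)
    then show ?thesis using det[OF f(1,3)] det[OF f(2,4)] by simp
  qed
qed

end

end

theory Submission
  imports Defs "HOL-Analysis.Function_Topology" "HOL-Combinatorics.Transposition"
begin

text \<open>
  Call a group \<open>k\<close>-bounded if each of its amenable actions on a countably infinite set has an
  orbit with at most \<open>k\<close> points.  A countable group has virtually (F) if and only if it is
  \<open>k\<close>-bounded for some \<open>k\<close>: the less obvious half is \<open>small_orbits_virtually_F\<close>, proved with
  induced actions.  The two alternatives exclude each other because an orbit that is finite and
  the whole space leaves no room for a faithful action of an infinite group.

  Suppose that there are finitely many factors, all with (F) except for one, \<open>G j\<close>, which has
  virtually (F).  For any invariant mean a group with (F) fixes almost every point.  Hence almost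
  every point has a \<open>G j\<close>-orbit of bounded size consisting of points fixed by all other factors;
  this orbit is invariant under the free product, which is therefore \<open>k\<close>-bounded
  (\<open>free_product_virtually_F\<close>).

  Otherwise a faithful transitive amenable action must be built, and an action of the free
  product is nothing but a family of actions of the factors on one set.  The criterion
  \<open>free_product_class_A\<close> starts from a sequence of sets \<open>Y k\<close> with such families of actions,
  with means \<open>m k\<close> each of which is eventually invariant under any given factor, and with sets
  \<open>T k\<close> meeting all orbits and fixed pointwise by one factor \<open>G i0\<close>.  If \<open>m k (T k)\<close> tends to
  zero, then the union of the \<open>T k\<close> is a null set for a limit mean on the disjoint union of the
  \<open>Y k\<close>, so that \<open>G i0\<close> may be made to act on it in any way without affecting invariance.  That
  freedom suffices to make the action transitive, and faithful after adding a copy of the free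
  product.  The hypotheses of the criterion hold in each of the remaining cases.

  \<^item> Some factor has not virtually (F).  It has, for each \<open>k\<close>, an amenable action all of whose
  orbits have more than \<open>k\<close> points.  There are then \<open>k + 1\<close> disjoint transversals, one of which
  has measure at most \<open>1 / (k + 1)\<close>; the other factors act trivially.

  \<^item> Two factors have virtually (F) but not (F).  Both act transitively on finite sets with at
  least two points, and copies of these sets can be strung together to arbitrarily long finite
  chains on which the two factors jointly act transitively.

  \<^item> There are infinitely many factors.  Then different factors can be used to connect the points
  of the different sets \<open>Y k\<close>, so that every factor acts trivially on all but one of them.
\<close>


section \<open>Actions by unrestricted functions\<close>

text \<open>In \<^const>\<open>group_action\<close> the maps must be undefined outside the set acted upon.  The
  constructions below glue and transport actions, where that convention only gets in the way;
  \<open>acts\<close> drops it, and \<open>acts_group_action\<close> restores it.\<close>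

definition acts :: "('a, 'm) monoid_scheme \<Rightarrow> 'x set \<Rightarrow> ('a \<Rightarrow> 'x \<Rightarrow> 'x) \<Rightarrow> bool" where
  "acts G X f \<longleftrightarrow>
     (\<forall>g\<in>carrier G. \<forall>x\<in>X. f g x \<in> X) \<and> (\<forall>x\<in>X. f \<one>\<^bsub>G\<^esub> x = x) \<and>
     (\<forall>g\<in>carrier G. \<forall>h\<in>carrier G. \<forall>x\<in>X. f (g \<otimes>\<^bsub>G\<^esub> h) x = f g (f h x))"

lemma actsI:
  assumes "\<And>g x. g \<in> carrier G \<Longrightarrow> x \<in> X \<Longrightarrow> f g x \<in> X"
    and "\<And>x. x \<in> X \<Longrightarrow> f \<one>\<^bsub>G\<^esub> x = x"
    and "\<And>g h x. g \<in> carrier G \<Longrightarrow> h \<in> carrier G \<Longrightarrow> x \<in> X \<Longrightarrow> f (g \<otimes>\<^bsub>G\<^esub> h) x = f g (f h x)"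
  shows "acts G X f"
  using assms by (auto simp: acts_def)

lemma acts_closed: "acts G X f \<Longrightarrow> g \<in> carrier G \<Longrightarrow> x \<in> X \<Longrightarrow> f g x \<in> X"
  and acts_one: "acts G X f \<Longrightarrow> x \<in> X \<Longrightarrow> f \<one>\<^bsub>G\<^esub> x = x"
  and acts_mult: "acts G X f \<Longrightarrow> g \<in> carrier G \<Longrightarrow> h \<in> carrier G \<Longrightarrow> x \<in> X \<Longrightarrow>
    f (g \<otimes>\<^bsub>G\<^esub> h) x = f g (f h x)"
  by (auto simp: acts_def)

lemma acts_inv:
  assumes "acts G X f" "group G" "g \<in> carrier G" "x \<in> X"
  shows "f (inv\<^bsub>G\<^esub> g) (f g x) = x" "f g (f (inv\<^bsub>G\<^esub> g) x) = x"
proof -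
  interpret group G by fact
  show "f (inv\<^bsub>G\<^esub> g) (f g x) = x"
    using acts_mult[OF assms(1), of "inv\<^bsub>G\<^esub> g" g x] assms acts_one[OF assms(1)] by simp
  show "f g (f (inv\<^bsub>G\<^esub> g) x) = x"
    using acts_mult[OF assms(1), of g "inv\<^bsub>G\<^esub> g" x] assms acts_one[OF assms(1)] by simp
qed

lemma acts_inj_on:
  assumes "acts G X f" "group G" "g \<in> carrier G"
  shows "inj_on (f g) X"
  by (rule inj_on_inverseI[of _ "f (inv\<^bsub>G\<^esub> g)"]) (rule acts_inv[OF assms])

lemma acts_surj:
  assumes "acts G X f" "group G" "g \<in> carrier G"
  shows "f g ` X = X"
proof
  show "f g ` X \<subseteq> X" using acts_closed[OF assms(1,3)] by auto
  show "X \<subseteq> f g ` X"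
  proof
    fix x assume "x \<in> X"
    then show "x \<in> f g ` X"
      using acts_inv(2)[OF assms, of x] acts_closed[OF assms(1), of "inv\<^bsub>G\<^esub> g" x]
        assms(2,3) by (metis image_eqI group.inv_closed)
  qed
qed

lemma acts_group_action:
  assumes "acts G X f" "group G"
  shows "group_action G X (\<lambda>g. restrict (f g) X)"
proof -
  have "restrict (f g) X \<in> Bij X" if "g \<in> carrier G" for g
    using acts_inj_on[OF assms that] acts_surj[OF assms that]
    by (auto simp: Bij_def bij_betw_def inj_on_restrict_eq)
  moreover have "restrict (f (g \<otimes>\<^bsub>G\<^esub> h)) X = compose X (restrict (f g) X) (restrict (f h) X)"
    if "g \<in> carrier G" "h \<in> carrier G" for g h
    using that acts_mult[OF assms(1) that] acts_closed[OF assms(1)] by (fastforce simp: compose_def)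
  ultimately have "(\<lambda>g. restrict (f g) X) \<in> hom G (BijGroup X)"
    by (auto simp: hom_def BijGroup_def)
  then show ?thesis
    using assms(2) group_BijGroup
    by (simp add: group_action_def group_hom_def group_hom_axioms_def)
qed

lemma group_action_acts:
  assumes "group_action G X \<phi>"
  shows "acts G X \<phi>"
proof -
  interpret group_action G X \<phi> by fact
  have "\<phi> \<one>\<^bsub>G\<^esub> x = x" if "x \<in> X" for x
    using fun_cong[OF id_eq_one, of x] that by simp
  then show ?thesis
    by (intro actsI) (auto intro: element_image composition_rule)
qed

lemma acts_hom:
  assumes "acts K X f" "h \<in> hom G K" "group G" "group K"
  shows "acts G X (\<lambda>g. f (h g))"
proof -
  have "h \<one>\<^bsub>G\<^esub> = \<one>\<^bsub>K\<^esub>" using assms(2-4) by (rule hom_one)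
  then show ?thesis
    using assms(1,2) unfolding acts_def by (auto simp: hom_def Pi_iff)
qed

lemma acts_subgroup:
  assumes "acts G X f" "subgroup H G"
  shows "acts (G\<lparr>carrier := H\<rparr>) X f"
proof -
  have "h \<in> carrier G" if "h \<in> H" for h using assms(2) that by (rule subgroup.mem_carrier)
  with assms(1) show ?thesis by (auto simp: acts_def)
qed

lemma acts_subset:
  "acts G X f \<Longrightarrow> Y \<subseteq> X \<Longrightarrow> (\<And>g x. g \<in> carrier G \<Longrightarrow> x \<in> Y \<Longrightarrow> f g x \<in> Y) \<Longrightarrow> acts G Y f"
  by (auto simp: acts_def subset_iff)

lemma acts_on_itself: "group G \<Longrightarrow> acts G (carrier G) (\<lambda>g x. g \<otimes>\<^bsub>G\<^esub> x)"
  by (auto simp: acts_def group.is_monoid monoid.m_closed monoid.m_assoc)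

lemma acts_trivially: "acts G X (\<lambda>g x. x)"
  by (simp add: acts_def)

lemma orbit_restrict:
  assumes "x \<in> X"
  shows "orbit G (\<lambda>g. restrict (f g) X) x = orbit G f x"
  using assms by (auto simp: orbit_def)

lemma orbit_subset: "acts G X f \<Longrightarrow> x \<in> X \<Longrightarrow> orbit G f x \<subseteq> X"
  by (auto simp: orbit_def acts_def)

lemma orbit_self: "acts G X f \<Longrightarrow> group G \<Longrightarrow> x \<in> X \<Longrightarrow> x \<in> orbit G f x"
  unfolding orbit_def using acts_one by (force intro: group.is_monoid monoid.one_closed)

lemma orbit_act:
  assumes act: "acts G X f" and "group G" and g: "g \<in> carrier G" and x: "x \<in> X"
  shows "orbit G f (f g x) = orbit G f x"
proof -
  interpret group G by fact
  have "f h (f g x) \<in> orbit G f x" if h: "h \<in> carrier G" for h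
    using acts_mult[OF act h g x] g h unfolding orbit_def by (metis (mono_tags, lifting) m_closed mem_Collect_eq)
  moreover have "f h x \<in> orbit G f (f g x)" if h: "h \<in> carrier G" for h
  proof -
    have "f h x = f (h \<otimes>\<^bsub>G\<^esub> inv\<^bsub>G\<^esub> g) (f g x)"
      using acts_mult[OF act _ g x, of "h \<otimes>\<^bsub>G\<^esub> inv\<^bsub>G\<^esub> g"] g h by (simp add: m_assoc)
    then show ?thesis using g h unfolding orbit_def by blast
  qed
  ultimately show ?thesis unfolding orbit_def[of G f "f g x"] by (auto simp: orbit_def)
qed


section \<open>Means\<close>

definition mean_on :: "'x set \<Rightarrow> ('x set \<Rightarrow> real) \<Rightarrow> bool" where
  "mean_on X m \<longleftrightarrow>
     (\<forall>A. A \<subseteq> X \<longrightarrow> 0 \<le> m A \<and> m A \<le> 1) \<and>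
     (\<forall>A B. A \<subseteq> X \<longrightarrow> B \<subseteq> X \<longrightarrow> A \<inter> B = {} \<longrightarrow> m (A \<union> B) = m A + m B) \<and> m X = 1"

definition preserves :: "('a, 'm) monoid_scheme \<Rightarrow> 'x set \<Rightarrow> ('a \<Rightarrow> 'x \<Rightarrow> 'x) \<Rightarrow> ('x set \<Rightarrow> real) \<Rightarrow> bool"
  where "preserves G X f m \<longleftrightarrow> (\<forall>g\<in>carrier G. \<forall>A. A \<subseteq> X \<longrightarrow> m (f g ` A) = m A)"

lemma invariant_mean_iff: "invariant_mean G X f m \<longleftrightarrow> mean_on X m \<and> preserves G X f m"
  by (auto simp: invariant_mean_def mean_on_def preserves_def)

lemma mean_nonneg: "mean_on X m \<Longrightarrow> A \<subseteq> X \<Longrightarrow> 0 \<le> m A"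
  and mean_le_one: "mean_on X m \<Longrightarrow> A \<subseteq> X \<Longrightarrow> m A \<le> 1"
  and mean_space: "mean_on X m \<Longrightarrow> m X = 1"
  and mean_Un: "mean_on X m \<Longrightarrow> A \<subseteq> X \<Longrightarrow> B \<subseteq> X \<Longrightarrow> A \<inter> B = {} \<Longrightarrow> m (A \<union> B) = m A + m B"
  by (auto simp: mean_on_def)

lemma mean_empty: "mean_on X m \<Longrightarrow> m {} = 0"
  using mean_Un[of X m "{}" "{}"] by simp

lemma mean_Diff:
  assumes "mean_on X m" "A \<subseteq> B" "B \<subseteq> X"
  shows "m (B - A) = m B - m A"
proof -
  have "m (A \<union> (B - A)) = m A + m (B - A)" using assms by (intro mean_Un[OF assms(1)]) auto
  moreover have "A \<union> (B - A) = B" using assms(2) by auto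
  ultimately show ?thesis by simp
qed

lemma mean_mono: "mean_on X m \<Longrightarrow> A \<subseteq> B \<Longrightarrow> B \<subseteq> X \<Longrightarrow> m A \<le> m B"
  using mean_Diff[of X m A B] mean_nonneg[of X m "B - A"] by auto

lemma mean_subadditive:
  assumes m: "mean_on X m" and "A \<subseteq> X" "B \<subseteq> X"
  shows "m (A \<union> B) \<le> m A + m B"
proof -
  have "m (A \<union> (B - A)) = m A + m (B - A)" using assms by (intro mean_Un[OF m]) auto
  moreover have "m (B - A) \<le> m B" using assms by (intro mean_mono[OF m]) auto
  ultimately show ?thesis by simp
qed

lemma mean_disjoint_Union:
  assumes m: "mean_on X m" and "finite J" "\<And>j. j \<in> J \<Longrightarrow> T j \<subseteq> X" "disjoint_family_on T J"
  shows "m (\<Union>j\<in>J. T j) = (\<Sum>j\<in>J. m (T j))"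
  using assms(2-)
proof (induction J rule: finite_induct)
  case empty
  then show ?case using mean_empty[OF m] by simp
next
  case (insert j J)
  have "T j \<inter> (\<Union>j\<in>J. T j) = {}"
    using insert.prems(2) insert.hyps(2) by (fastforce simp: disjoint_family_on_def)
  moreover have "m (\<Union>j\<in>J. T j) = (\<Sum>j\<in>J. m (T j))"
    using insert.prems by (intro insert.IH) (auto simp: disjoint_family_on_def)
  moreover have "(\<Union>j\<in>J. T j) \<subseteq> X" using insert.prems(1) by auto
  ultimately show ?case
    using insert mean_Un[OF m, of "T j" "\<Union>j\<in>J. T j"] by simp
qed

lemma mean_full_Int:
  assumes m: "mean_on X m" and "finite J" "\<And>j. j \<in> J \<Longrightarrow> A j \<subseteq> X" "\<And>j. j \<in> J \<Longrightarrow> m (A j) = 1"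
  shows "m {x \<in> X. \<forall>j\<in>J. x \<in> A j} = 1"
  using assms(2-)
proof (induction J rule: finite_induct)
  case empty
  then show ?case using mean_space[OF m] by simp
next
  case (insert j J)
  let ?B = "{x \<in> X. \<forall>j\<in>J. x \<in> A j}"
  have B: "m ?B = 1" using insert by auto
  have "X - {x \<in> X. \<forall>j\<in>insert j J. x \<in> A j} = (X - ?B) \<union> (X - A j)" by auto
  then have "m (X - {x \<in> X. \<forall>j\<in>insert j J. x \<in> A j}) \<le> m (X - ?B) + m (X - A j)"
    using mean_subadditive[OF m, of "X - ?B" "X - A j"] by auto
  moreover have "m (X - ?B) = 0" "m (X - A j) = 0"
    using mean_Diff[OF m, of ?B X] mean_Diff[OF m, of "A j" X] B insert.prems mean_space[OF m] by auto
  ultimately have "m (X - {x \<in> X. \<forall>j\<in>insert j J. x \<in> A j}) \<le> 0" by simp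
  moreover have "m (X - {x \<in> X. \<forall>j\<in>insert j J. x \<in> A j}) = 1 - m {x \<in> X. \<forall>j\<in>insert j J. x \<in> A j}"
    using mean_Diff[OF m, of "{x \<in> X. \<forall>j\<in>insert j J. x \<in> A j}" X] mean_space[OF m] by auto
  moreover have "m {x \<in> X. \<forall>j\<in>insert j J. x \<in> A j} \<le> 1"
    by (rule mean_le_one[OF m]) auto
  ultimately show ?case by linarith
qed

lemma uniform_mean:
  assumes "finite D" "D \<noteq> {}"
  shows "mean_on D (\<lambda>A. card A / card D)"
proof -
  have "card D > 0" using assms by (simp add: card_gt_0_iff)
  moreover have "card (A \<union> B) = card A + card B" if "A \<subseteq> D" "B \<subseteq> D" "A \<inter> B = {}" for A B
    using that assms(1) by (intro card_Un_disjoint) (auto intro: finite_subset)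
  ultimately show ?thesis
    using assms(1) by (auto simp: mean_on_def field_simps intro: card_mono)
qed

lemma uniform_mean_preserved:
  assumes "acts G D f" "group G"
  shows "preserves G D f (\<lambda>A. card A / card D)"
proof -
  have "card (f g ` A) = card A" if "g \<in> carrier G" "A \<subseteq> D" for g A
    using inj_on_subset[OF acts_inj_on[OF assms that(1)] that(2)] by (rule card_image)
  then show ?thesis by (simp add: preserves_def)
qed

lemma mean_condition:
  assumes m: "mean_on X m" and N: "N \<subseteq> X" "m N \<noteq> 0"
  shows "mean_on N (\<lambda>A. m A / m N)"
proof -
  have "m N > 0" using mean_nonneg[OF m N(1)] N(2) by simp
  moreover have "0 \<le> m A" "m A \<le> m N" if "A \<subseteq> N" for A
    using mean_nonneg[OF m] mean_mono[OF m that N(1)] that N(1) by auto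
  moreover have "m (A \<union> B) = m A + m B" if "A \<subseteq> N" "B \<subseteq> N" "A \<inter> B = {}" for A B
    using that N(1) by (intro mean_Un[OF m]) auto
  ultimately show ?thesis by (simp add: mean_on_def add_divide_distrib)
qed

lemma mean_pushforward:
  assumes m: "mean_on X m" and \<iota>: "\<iota> ` X \<subseteq> Z"
  shows "mean_on Z (\<lambda>A. m {x \<in> X. \<iota> x \<in> A})"
proof -
  have "m {x \<in> X. \<iota> x \<in> A \<union> B} = m {x \<in> X. \<iota> x \<in> A} + m {x \<in> X. \<iota> x \<in> B}" if "A \<inter> B = {}" for A B
  proof -
    have "{x \<in> X. \<iota> x \<in> A \<union> B} = {x \<in> X. \<iota> x \<in> A} \<union> {x \<in> X. \<iota> x \<in> B}" by auto
    then show ?thesis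
      using mean_Un[OF m, of "{x \<in> X. \<iota> x \<in> A}" "{x \<in> X. \<iota> x \<in> B}"] that by auto
  qed
  moreover have "{x \<in> X. \<iota> x \<in> Z} = X" using \<iota> by auto
  ultimately show ?thesis
    using mean_nonneg[OF m] mean_le_one[OF m] mean_space[OF m] by (simp add: mean_on_def)
qed

lemma preserves_pushforward:
  assumes G: "group G" and f: "acts G X f" and F: "acts G Z F" and m: "preserves G X f m"
    and \<iota>: "\<iota> ` X \<subseteq> Z" and eqv: "\<And>g x. g \<in> carrier G \<Longrightarrow> x \<in> X \<Longrightarrow> \<iota> (f g x) = F g (\<iota> x)"
  shows "preserves G Z F (\<lambda>A. m {x \<in> X. \<iota> x \<in> A})"
proof -
  have "{x \<in> X. \<iota> x \<in> F g ` A} = f g ` {x \<in> X. \<iota> x \<in> A}" if g: "g \<in> carrier G" and A: "A \<subseteq> Z" for g A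
  proof
    show "f g ` {x \<in> X. \<iota> x \<in> A} \<subseteq> {x \<in> X. \<iota> x \<in> F g ` A}"
      using eqv[OF g] acts_closed[OF f g] by auto
    show "{x \<in> X. \<iota> x \<in> F g ` A} \<subseteq> f g ` {x \<in> X. \<iota> x \<in> A}"
    proof
      fix x assume "x \<in> {x \<in> X. \<iota> x \<in> F g ` A}"
      then obtain a where a: "x \<in> X" "a \<in> A" "\<iota> x = F g a" by auto
      obtain y where y: "y \<in> X" "x = f g y" using acts_surj[OF f G g] a(1) by auto
      then have "F g (\<iota> y) = F g a" using eqv[OF g] a(3) by simp
      then have "\<iota> y = a"
        using acts_inj_on[OF F G g] y(1) a(2) \<iota> A by (auto dest: inj_onD)
      then show "x \<in> f g ` {x \<in> X. \<iota> x \<in> A}" using y a(2) by auto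
    qed
  qed
  moreover have "m (f g ` {x \<in> X. \<iota> x \<in> A}) = m {x \<in> X. \<iota> x \<in> A}" if "g \<in> carrier G" for g A
    using m that by (auto simp: preserves_def)
  ultimately show ?thesis by (simp add: preserves_def)
qed

lemma acts_amenable:
  assumes "acts G X f" "group G" "invariant_mean G X f m"
  shows "amenable_action G X (\<lambda>g. restrict (f g) X)"
proof -
  have "restrict (f g) X ` A = f g ` A" if "A \<subseteq> X" for g A
    using that by (auto simp: subset_iff image_iff)
  then have "invariant_mean G X (\<lambda>g. restrict (f g) X) m"
    using assms(3) by (simp add: invariant_mean_iff preserves_def)
  then show ?thesis
    using acts_group_action[OF assms(1,2)] by (auto simp: amenable_action_def)
qed

lemma property_F_group: "property_F G \<Longrightarrow> group G"
  by (simp add: property_F_def countable_group_def)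

lemma property_F_fixed_point:
  assumes "property_F G" "countably_infinite X" "acts G X f" "invariant_mean G X f m"
  shows "\<exists>x\<in>X. \<forall>g\<in>carrier G. f g x = x"
  using property_F_D[OF assms(1,2) acts_amenable[OF assms(3) property_F_group[OF assms(1)] assms(4)]]
  by (auto simp: has_fixed_point_def)

text \<open>If the set \<open>N\<close> of points moved by the group had positive measure, the normalised mean on
  \<open>N\<close> would violate the fixed point property.  The property speaks of infinite sets only, hence
  the product with \<open>\<nat>\<close>.\<close>

lemma property_F_fixed_points_full:
  assumes F: "property_F G" and X: "countable X" and act: "acts G X f" and inv: "invariant_mean G X f m"
  shows "m {x \<in> X. \<forall>g\<in>carrier G. f g x = x} = 1"
proof (rule ccontr)
  interpret group G using property_F_group[OF F] .
  let ?Fix = "{x \<in> X. \<forall>g\<in>carrier G. f g x = x}"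
  define N where "N = X - ?Fix"
  have m: "mean_on X m" "preserves G X f m" using inv by (auto simp: invariant_mean_iff)
  assume "m ?Fix \<noteq> 1"
  then have N: "m N \<noteq> 0" using mean_Diff[OF m(1), of ?Fix X] mean_space[OF m(1)] by (auto simp: N_def)
  have NX: "N \<subseteq> X" by (auto simp: N_def)
  have ne: "N \<noteq> {}" using N mean_empty[OF m(1)] by auto
  have closed: "f g x \<in> N" if g: "g \<in> carrier G" and x: "x \<in> N" for g x
  proof -
    have xX: "x \<in> X" using x NX by auto
    have "f g x \<notin> ?Fix"
    proof
      assume that: "f g x \<in> ?Fix"
      have "f (inv\<^bsub>G\<^esub> g) (f g x) = f g x" using that g by auto
      then have "f g x = x" using acts_inv(1)[OF act is_group g xX] by simp
      then have "x \<in> ?Fix" using that by simp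
      then show False using x by (simp add: N_def)
    qed
    then show ?thesis using acts_closed[OF act g xX] unfolding N_def by (rule DiffI[rotated])
  qed
  have actN: "acts G N f" using acts_subset[OF act NX] closed by auto
  let ?Z = "N \<times> (UNIV :: nat set)" and ?F = "\<lambda>g (x, k). (f g x, k)"
  let ?M = "\<lambda>A. m {x \<in> N. (x, 0::nat) \<in> A} / m N"
  have actZ: "acts G ?Z ?F" using actN unfolding acts_def by auto
  moreover have "countably_infinite ?Z"
    using X NX ne by (auto simp: countably_infinite_def finite_cartesian_product_iff intro: countable_subset)
  moreover have "mean_on ?Z ?M"
    by (rule mean_pushforward[OF mean_condition[OF m(1) NX N]]) auto
  moreover have "preserves G N f (\<lambda>A. m A / m N)"
    using m(2) NX by (simp add: preserves_def subset_trans)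
  then have "preserves G ?Z ?F ?M"
    by (rule preserves_pushforward[OF is_group actN actZ]) auto
  ultimately obtain z where "z \<in> ?Z" "\<forall>g\<in>carrier G. ?F g z = z"
    using property_F_fixed_point[OF F] by (fastforce simp: invariant_mean_iff)
  then show False by (auto simp: N_def)
qed


section \<open>Finite orbits and subgroups of finite index\<close>

lemma acts_transport:
  assumes act: "acts G X f" and b: "bij_betw b X Y"
  shows "acts G Y (\<lambda>g y. b (f g (inv_into X b y)))"
proof -
  have "inv_into X b (b x) = x" if "x \<in> X" for x using that b by (simp add: bij_betw_def)
  moreover have "inv_into X b y \<in> X" "b (inv_into X b y) = y" if "y \<in> Y" for y
    using that b by (auto simp: bij_betw_def f_inv_into_f inv_into_into)
  moreover have "b x \<in> Y" if "x \<in> X" for x using that b by (auto simp: bij_betw_def)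
  ultimately show ?thesis using act by (simp add: acts_def)
qed

lemma orbit_acts_transport:
  assumes "bij_betw b X Y" "x \<in> X"
  shows "orbit G (\<lambda>g y. b (f g (inv_into X b y))) (b x) = b ` orbit G f x"
proof -
  have "inv_into X b (b x) = x" using assms by (simp add: bij_betw_def)
  then show ?thesis by (auto simp: orbit_def)
qed

lemma orbit_stabilizer_index:
  assumes "acts K X f" "group K" "x \<in> X" "finite (orbit K f x)"
  obtains U where "subgroup U K" "finite (rcosets\<^bsub>K\<^esub> U)" "card (rcosets\<^bsub>K\<^esub> U) = card (orbit K f x)"
proof -
  let ?\<phi> = "\<lambda>g. restrict (f g) X"
  interpret group_action K X ?\<phi> using acts_group_action[OF assms(1,2)] .
  let ?U = "stabilizer K ?\<phi> x"
  have "bij_betw (\<lambda>R. ?\<phi> (inv\<^bsub>K\<^esub> (SOME h. h \<in> R)) x) (rcosets\<^bsub>K\<^esub> ?U) (orbit K f x)"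
    using orbit_stab_fun_is_bij[OF assms(3)] by (simp only: orbit_restrict[OF assms(3)])
  then have "finite (rcosets\<^bsub>K\<^esub> ?U)" "card (rcosets\<^bsub>K\<^esub> ?U) = card (orbit K f x)"
    using assms(4) by (auto simp: bij_betw_finite bij_betw_same_card)
  with stabilizer_subgroup[OF assms(3)] show thesis by (rule that)
qed

lemma orbit_of_fixed_point:
  assumes act: "acts K X f" and "group K" and H: "subgroup H K" and fin: "finite (rcosets\<^bsub>K\<^esub> H)"
    and x: "x \<in> X" and fixed: "\<And>h. h \<in> H \<Longrightarrow> f h x = x"
  shows "finite (orbit K f x)" "card (orbit K f x) \<le> card (rcosets\<^bsub>K\<^esub> H)"
proof -
  interpret group K by fact
  interpret H: subgroup H K by fact
  let ?e = "\<lambda>R. f (inv\<^bsub>K\<^esub> (SOME r. r \<in> R)) x"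
  have sub: "orbit K f x \<subseteq> ?e ` (rcosets\<^bsub>K\<^esub> H)"
  proof
    fix y assume "y \<in> orbit K f x"
    then obtain g where g: "g \<in> carrier K" "y = f g x" by (auto simp: orbit_def)
    let ?R = "H #>\<^bsub>K\<^esub> inv\<^bsub>K\<^esub> g"
    have "inv\<^bsub>K\<^esub> g \<in> ?R" using g(1) H by (intro rcos_self) auto
    then have "(SOME r. r \<in> ?R) \<in> ?R" by (rule someI)
    then obtain h where h: "h \<in> H" "(SOME r. r \<in> ?R) = h \<otimes>\<^bsub>K\<^esub> inv\<^bsub>K\<^esub> g" by (auto simp: r_coset_def)
    have "?e ?R = f (g \<otimes>\<^bsub>K\<^esub> inv\<^bsub>K\<^esub> h) x" using h g by (simp add: inv_mult_group)
    also have "\<dots> = y"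
      using acts_mult[OF act g(1) _ x, of "inv\<^bsub>K\<^esub> h"] fixed[of "inv\<^bsub>K\<^esub> h"] h(1) g(2) by simp
    finally show "y \<in> ?e ` (rcosets\<^bsub>K\<^esub> H)" using g(1) H.subset by (force intro: rcosetsI)
  qed
  then show "finite (orbit K f x)" "card (orbit K f x) \<le> card (rcosets\<^bsub>K\<^esub> H)"
    using fin by (auto intro: finite_surj surj_card_le)
qed

lemma acts_on_rcosets:
  assumes "group K" "subgroup N K"
  shows "acts K (rcosets\<^bsub>K\<^esub> N) (\<lambda>g R. R #>\<^bsub>K\<^esub> inv\<^bsub>K\<^esub> g)"
proof (intro actsI)
  interpret group K by fact
  interpret N: subgroup N K by fact
  fix R assume R: "R \<in> rcosets\<^bsub>K\<^esub> N"
  then have Rc: "R \<subseteq> carrier K" using N.rcosets_carrier[OF is_group] by auto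
  obtain r where r: "r \<in> carrier K" "R = N #>\<^bsub>K\<^esub> r" using R by (auto simp: RCOSETS_def)
  show "R #>\<^bsub>K\<^esub> inv\<^bsub>K\<^esub> g \<in> rcosets\<^bsub>K\<^esub> N" if "g \<in> carrier K" for g
    using r that N.subset by (simp add: coset_mult_assoc rcosetsI)
  show "R #>\<^bsub>K\<^esub> inv\<^bsub>K\<^esub> \<one>\<^bsub>K\<^esub> = R" using Rc by simp
  show "R #>\<^bsub>K\<^esub> inv\<^bsub>K\<^esub> (g \<otimes>\<^bsub>K\<^esub> h) = R #>\<^bsub>K\<^esub> inv\<^bsub>K\<^esub> h #>\<^bsub>K\<^esub> inv\<^bsub>K\<^esub> g"
    if "g \<in> carrier K" "h \<in> carrier K" for g h
    using that Rc by (simp add: inv_mult_group coset_mult_assoc)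
qed

lemma rcosets_transitive:
  assumes "group K" "subgroup N K" "R \<in> rcosets\<^bsub>K\<^esub> N" "R' \<in> rcosets\<^bsub>K\<^esub> N"
  obtains g where "g \<in> carrier K" "R #>\<^bsub>K\<^esub> inv\<^bsub>K\<^esub> g = R'"
proof -
  interpret group K by fact
  interpret N: subgroup N K by fact
  obtain r r' where r: "r \<in> carrier K" "R = N #>\<^bsub>K\<^esub> r" and r': "r' \<in> carrier K" "R' = N #>\<^bsub>K\<^esub> r'"
    using assms by (auto simp: RCOSETS_def)
  have "R #>\<^bsub>K\<^esub> inv\<^bsub>K\<^esub> (inv\<^bsub>K\<^esub> r' \<otimes>\<^bsub>K\<^esub> r) = R'"
    using r r' N.subset by (simp add: inv_mult_group coset_mult_assoc m_assoc[symmetric])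
  then show thesis using r r' by (intro that[of "inv\<^bsub>K\<^esub> r' \<otimes>\<^bsub>K\<^esub> r"]) auto
qed

lemma finite_index_infinite:
  assumes "group K" "subgroup N K" "finite (rcosets\<^bsub>K\<^esub> N)" "infinite (carrier K)"
  shows "infinite N"
proof
  interpret group K by fact
  assume "finite N"
  then have "finite R" if "R \<in> rcosets\<^bsub>K\<^esub> N" for R
    using that by (auto simp: RCOSETS_def r_coset_def)
  then have "finite (\<Union>(rcosets\<^bsub>K\<^esub> N))" using assms(3) by blast
  then show False using assms(4) rcosets_part_G[OF assms(2)] by simp
qed


section \<open>Virtual fixed points\<close>

text \<open>Existence of a uniformly small orbit in every amenable action is equivalent to virtual
  property (F) for countable groups.  It speaks about one action at a time and does not ask for a
  subgroup, which makes it accessible in free products.\<close>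

definition small_orbits :: "('a, 'm) monoid_scheme \<Rightarrow> nat \<Rightarrow> bool" where
  "small_orbits K k \<longleftrightarrow>
     (\<forall>(X :: nat set) f m. countably_infinite X \<longrightarrow> acts K X f \<longrightarrow> invariant_mean K X f m \<longrightarrow>
        (\<exists>x\<in>X. finite (orbit K f x) \<and> card (orbit K f x) \<le> k))"

lemma small_orbitsD:
  assumes K: "group K" "small_orbits K k"
    and X: "countably_infinite X" and act: "acts K X f" and m: "invariant_mean K X f m"
  shows "\<exists>x\<in>X. finite (orbit K f x) \<and> card (orbit K f x) \<le> k"
proof -
  obtain b where b: "bij_betw b X (UNIV :: nat set)"
    using X by (auto simp: countably_infinite_def intro: to_nat_on_infinite)
  let ?f = "\<lambda>g y. b (f g (inv_into X b y))"
  have act': "acts K UNIV ?f" by (rule acts_transport[OF act b])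
  have "preserves K UNIV ?f (\<lambda>A. m {x \<in> X. b x \<in> A})"
    using b m by (intro preserves_pushforward[OF K(1) act act'])
      (auto simp: invariant_mean_iff bij_betw_def)
  moreover have "mean_on UNIV (\<lambda>A. m {x \<in> X. b x \<in> A})"
    using m by (intro mean_pushforward) (auto simp: invariant_mean_iff)
  ultimately obtain y where y: "finite (orbit K ?f y)" "card (orbit K ?f y) \<le> k"
    using K(2) act' unfolding small_orbits_def invariant_mean_iff countably_infinite_def by blast
  obtain x where x: "x \<in> X" "y = b x" using b by (auto simp: bij_betw_def)
  have "inj_on b (orbit K f x)"
    using b orbit_subset[OF act x(1)] by (auto simp: bij_betw_def intro: inj_on_subset)
  then show ?thesis
    using y x orbit_acts_transport[OF b x(1), of K f] by (auto simp: finite_image_iff card_image)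
qed

text \<open>The group permutes the cosets transitively and preserves the uniform mean on them.  Infinitely
  many copies of this finite set form an infinite one all of whose orbits have the size of the
  index.\<close>

lemma small_orbits_index_bound:
  assumes "group K" "small_orbits K k" "subgroup N K" "finite (rcosets\<^bsub>K\<^esub> N)"
  shows "card (rcosets\<^bsub>K\<^esub> N) \<le> k"
proof -
  interpret group K by fact
  let ?D = "rcosets\<^bsub>K\<^esub> N" and ?f = "\<lambda>g R. R #>\<^bsub>K\<^esub> inv\<^bsub>K\<^esub> g"
  let ?Z = "?D \<times> (UNIV :: nat set)" and ?F = "\<lambda>g (R, j :: nat). (?f g R, j)"
  let ?M = "\<lambda>A. card {R \<in> ?D. (R, 0) \<in> A} / card ?D"
  have ne: "?D \<noteq> {}" using subgroup.subgroup_in_rcosets[OF assms(3,1)] by auto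
  have act: "acts K ?D ?f" by (rule acts_on_rcosets[OF assms(1,3)])
  then have actZ: "acts K ?Z ?F" by (auto simp: acts_def)
  have "preserves K ?Z ?F ?M"
    by (rule preserves_pushforward[OF assms(1) act actZ uniform_mean_preserved[OF act assms(1)]]) auto
  moreover have "mean_on ?Z ?M"
    by (rule mean_pushforward[OF uniform_mean[OF assms(4) ne]]) auto
  moreover have "countably_infinite ?Z"
    using ne assms(4) by (auto simp: countably_infinite_def finite_cartesian_product_iff countable_finite)
  ultimately obtain R j where Rj: "R \<in> ?D" "finite (orbit K ?F (R, j))" "card (orbit K ?F (R, j)) \<le> k"
    using small_orbitsD[OF assms(1,2) _ actZ, of ?M] by (auto simp: invariant_mean_iff)
  have "(\<lambda>R. (R, j)) ` ?D \<subseteq> orbit K ?F (R, j)"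
  proof safe
    fix R' assume "R' \<in> ?D"
    then obtain g where "g \<in> carrier K" "?f g R = R'"
      using rcosets_transitive[OF assms(1,3) Rj(1)] by blast
    then show "(R', j) \<in> orbit K ?F (R, j)" by (force simp: orbit_def)
  qed
  then have "card ((\<lambda>R. (R, j)) ` ?D) \<le> card (orbit K ?F (R, j))"
    using Rj(2) by (rule card_mono[rotated])
  moreover have "card ((\<lambda>R. (R, j)) ` ?D) = card ?D" by (rule card_image) (auto simp: inj_on_def)
  ultimately show ?thesis using Rj(3) by simp
qed

text \<open>The action induced from a subgroup \<open>N\<close> of finite index, written with a section \<open>s\<close> of
  the projection to the cosets; the invariant mean averages copies of the given one over the
  cosets.\<close>

lemma induced_action:
  fixes K :: "('a, 'm) monoid_scheme" and X :: "'x set"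
  assumes "group K" "subgroup N K" and fin: "finite (rcosets\<^bsub>K\<^esub> N)"
    and act: "acts (K\<lparr>carrier := N\<rparr>) X f" and m: "invariant_mean (K\<lparr>carrier := N\<rparr>) X f m"
  obtains F M where "acts K ((rcosets\<^bsub>K\<^esub> N) \<times> X) F" "invariant_mean K ((rcosets\<^bsub>K\<^esub> N) \<times> X) F M"
    "\<And>g R x. fst (F g (R, x)) = R #>\<^bsub>K\<^esub> inv\<^bsub>K\<^esub> g"
    "\<And>n x. n \<in> N \<Longrightarrow> x \<in> X \<Longrightarrow> F n (N, x) = (N, f n x)"
proof -
  interpret group K by fact
  interpret N: subgroup N K by fact
  let ?D = "rcosets\<^bsub>K\<^esub> N" and ?r = "\<lambda>g R. R #>\<^bsub>K\<^esub> inv\<^bsub>K\<^esub> g"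
  have actD: "acts K ?D ?r" by (rule acts_on_rcosets[OF assms(1,2)])
  define s where "s R = (if R = N then \<one>\<^bsub>K\<^esub> else SOME r. r \<in> R)" for R
  have s: "s R \<in> R" if "R \<in> ?D" for R
    using that N.rcosets_non_empty[of R] by (auto simp: s_def some_in_eq)
  have sc: "s R \<in> carrier K" if "R \<in> ?D" for R
    using s[OF that] N.rcosets_carrier[OF is_group that] by auto
  define c where "c g R = s (?r g R) \<otimes>\<^bsub>K\<^esub> g \<otimes>\<^bsub>K\<^esub> inv\<^bsub>K\<^esub> s R" for g R
  have rD: "?r g R \<in> ?D" if "g \<in> carrier K" "R \<in> ?D" for g R using acts_closed[OF actD that] .
  have cN: "c g R \<in> N" if g: "g \<in> carrier K" and R: "R \<in> ?D" for g R
  proof -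
    obtain a where a: "a \<in> carrier K" "R = N #>\<^bsub>K\<^esub> a" using R by (auto simp: RCOSETS_def)
    have "R = N #>\<^bsub>K\<^esub> s R" using repr_independence[of "s R" N a] s[OF R] a assms(2) by simp
    then have "?r g R = N #>\<^bsub>K\<^esub> (s R \<otimes>\<^bsub>K\<^esub> inv\<^bsub>K\<^esub> g)"
      using coset_mult_assoc[of N "s R" "inv\<^bsub>K\<^esub> g"] sc[OF R] g N.subset by simp
    then obtain n where n: "n \<in> N" "s (?r g R) = n \<otimes>\<^bsub>K\<^esub> (s R \<otimes>\<^bsub>K\<^esub> inv\<^bsub>K\<^esub> g)"
      using s[OF rD[OF g R]] by (auto simp: r_coset_def)
    have "c g R = n" unfolding c_def n(2) using n(1) g sc[OF R] N.mem_carrier by (simp add: m_assoc inv_mult_group)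
    then show ?thesis using n by simp
  qed
  have cc: "c (g \<otimes>\<^bsub>K\<^esub> h) R = c g (?r h R) \<otimes>\<^bsub>K\<^esub> c h R"
    if g: "g \<in> carrier K" and h: "h \<in> carrier K" and R: "R \<in> ?D" for g h R
  proof -
    have "?r (g \<otimes>\<^bsub>K\<^esub> h) R = ?r g (?r h R)" by (rule acts_mult[OF actD g h R])
    moreover have "inv\<^bsub>K\<^esub> s (?r h R) \<otimes>\<^bsub>K\<^esub> (s (?r h R) \<otimes>\<^bsub>K\<^esub> y) = y" if "y \<in> carrier K" for y
      using that sc[OF rD[OF h R]] by (simp add: m_assoc[symmetric])
    ultimately show ?thesis
      unfolding c_def using g h sc[OF R] sc[OF rD[OF h R]] sc[OF rD[OF g rD[OF h R]]] by (simp add: m_assoc)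
  qed
  have c1: "c \<one>\<^bsub>K\<^esub> R = \<one>\<^bsub>K\<^esub>" if R: "R \<in> ?D" for R
    unfolding c_def using acts_one[OF actD R] sc[OF R] by simp
  define F where "F g = (\<lambda>(R, x). (?r g R, f (c g R) x))" for g
  have fc: "f n x \<in> X" if "n \<in> N" "x \<in> X" for n x using acts_closed[OF act, of n x] that by simp
  have fm: "f (n \<otimes>\<^bsub>K\<^esub> n') x = f n (f n' x)" if "n \<in> N" "n' \<in> N" "x \<in> X" for n n' x
    using acts_mult[OF act, of n n' x] that by simp
  have f1: "f \<one>\<^bsub>K\<^esub> x = x" if "x \<in> X" for x using acts_one[OF act that] by simp
  let ?Z = "?D \<times> X"
  have actF: "acts K ?Z F"
  proof (intro actsI)
    fix z assume "z \<in> ?Z"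
    then obtain R x where z: "z = (R, x)" "R \<in> ?D" "x \<in> X" by auto
    show "F g z \<in> ?Z" if "g \<in> carrier K" for g
      using z rD[OF that z(2)] fc[OF cN[OF that z(2)] z(3)] by (simp add: F_def)
    show "F \<one>\<^bsub>K\<^esub> z = z" using z c1 f1 acts_one[OF actD z(2)] by (simp add: F_def)
    show "F (g \<otimes>\<^bsub>K\<^esub> h) z = F g (F h z)" if g: "g \<in> carrier K" and h: "h \<in> carrier K" for g h
      using z acts_mult[OF actD g h z(2)] cc[OF g h z(2)] fm[OF cN[OF g rD[OF h z(2)]] cN[OF h z(2)] z(3)]
      by (simp add: F_def)
  qed
  have ne: "?D \<noteq> {}" using N.subgroup_in_rcosets[OF assms(1)] by auto
  then have pos: "card ?D > 0" using fin by (simp add: card_gt_0_iff)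
  have mX: "mean_on X m" and mp: "\<And>n A. n \<in> N \<Longrightarrow> A \<subseteq> X \<Longrightarrow> m (f n ` A) = m A"
    using m by (auto simp: invariant_mean_iff preserves_def)
  define sl where "sl R A = {x \<in> X. (R, x) \<in> A}" for R :: "'a set" and A
  define M :: "('a set \<times> 'x) set \<Rightarrow> real" where "M A = (\<Sum>R\<in>?D. m (sl R A)) / real (card ?D)" for A
  have mR: "mean_on ?Z (\<lambda>A. m (sl R A))" if "R \<in> ?D" for R
    unfolding sl_def by (rule mean_pushforward[OF mX]) (use that in auto)
  have "mean_on ?Z M"
  proof -
    have "0 \<le> M A \<and> M A \<le> 1" if A: "A \<subseteq> ?Z" for A
    proof -
      have "(\<Sum>R\<in>?D. m (sl R A)) \<le> (\<Sum>R\<in>?D. 1)"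
        by (intro sum_mono mean_le_one[OF mR A])
      moreover have "0 \<le> (\<Sum>R\<in>?D. m (sl R A))"
        by (intro sum_nonneg mean_nonneg[OF mR A])
      ultimately show ?thesis using pos by (simp add: M_def)
    qed
    moreover have "M (A \<union> B) = M A + M B" if "A \<subseteq> ?Z" "B \<subseteq> ?Z" "A \<inter> B = {}" for A B
    proof -
      have "(\<Sum>R\<in>?D. m (sl R (A \<union> B))) = (\<Sum>R\<in>?D. m (sl R A) + m (sl R B))"
        using that by (intro sum.cong) (auto intro!: mean_Un[OF mR])
      then show ?thesis by (simp add: M_def sum.distrib add_divide_distrib)
    qed
    moreover have "(\<Sum>R\<in>?D. m (sl R ?Z)) = (\<Sum>R\<in>?D. 1)"
      by (intro sum.cong HOL.refl mean_space[OF mR])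
    then have "M ?Z = 1" using pos by (simp add: M_def)
    ultimately show ?thesis by (simp add: mean_on_def)
  qed
  moreover have "M (F g ` A) = M A" if g: "g \<in> carrier K" and A: "A \<subseteq> ?Z" for g A
  proof -
    have "sl (?r g R) (F g ` A) = f (c g R) ` sl R A" if R: "R \<in> ?D" for R
    proof
      show "f (c g R) ` sl R A \<subseteq> sl (?r g R) (F g ` A)"
        using fc[OF cN[OF g R]] by (force simp: sl_def F_def)
      show "sl (?r g R) (F g ` A) \<subseteq> f (c g R) ` sl R A"
      proof
        fix x assume "x \<in> sl (?r g R) (F g ` A)"
        then obtain R' x' where R': "(R', x') \<in> A" "?r g R' = ?r g R" "x = f (c g R') x'"
          by (auto simp: sl_def F_def)
        then have "R' = R" using acts_inj_on[OF actD assms(1) g] A R by (auto dest: inj_onD)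
        then show "x \<in> f (c g R) ` sl R A" using R' A by (auto simp: sl_def)
      qed
    qed
    then have "m (sl (?r g R) (F g ` A)) = m (sl R A)" if "R \<in> ?D" for R
      using mp[OF cN[OF g that], of "sl R A"] that by (auto simp: sl_def)
    then have "(\<Sum>R\<in>?D. m (sl R A)) = (\<Sum>R\<in>?D. m (sl (?r g R) (F g ` A)))" by simp
    also have "\<dots> = (\<Sum>R\<in>?r g ` ?D. m (sl R (F g ` A)))"
      using acts_inj_on[OF actD assms(1) g] by (simp add: sum.reindex)
    also have "?r g ` ?D = ?D" by (rule acts_surj[OF actD assms(1) g])
    finally show ?thesis by (simp add: M_def)
  qed
  ultimately have "invariant_mean K ?Z F M" by (simp add: invariant_mean_iff preserves_def)
  moreover have "F n (N, x) = (N, f n x)" if n: "n \<in> N" and x: "x \<in> X" for n x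
  proof -
    have "?r n N = N" using n by (intro coset_join2) (auto simp: assms(2))
    then show ?thesis using n x by (simp add: F_def c_def s_def)
  qed
  ultimately show thesis using actF by (intro that[of F M]) (auto simp: F_def)
qed

text \<open>Small orbits bound the index of all subgroups of finite index.  One of maximal index has
  property (F): were it to move every point of some amenable action, then the point stabilisers
  of a small orbit in the induced action would have larger index.\<close>

lemma small_orbits_virtually_F:
  assumes K: "countable_group K" and small: "small_orbits K k"
  shows "virtually_F K"
proof -
  interpret group K using K by (simp add: countable_group_def)
  let ?P = "\<lambda>N. subgroup N K \<and> finite (rcosets\<^bsub>K\<^esub> N)"
  have "carrier K #>\<^bsub>K\<^esub> a = carrier K" if "a \<in> carrier K" for a
    using that subgroup_self by (intro coset_join2)
  then have "rcosets\<^bsub>K\<^esub> (carrier K) \<subseteq> {carrier K}" by (auto simp: RCOSETS_def)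
  then have "?P (carrier K)" using subgroup_self finite_subset by auto
  moreover have "\<forall>N. ?P N \<longrightarrow> card (rcosets\<^bsub>K\<^esub> N) < Suc k"
    using small_orbits_index_bound[OF is_group small] by (simp add: less_Suc_eq_le)
  ultimately have "\<exists>N. ?P N \<and> (\<forall>U. ?P U \<longrightarrow> card (rcosets\<^bsub>K\<^esub> U) \<le> card (rcosets\<^bsub>K\<^esub> N))"
    by (rule ex_has_greatest_nat)
  then obtain N where N: "subgroup N K" "finite (rcosets\<^bsub>K\<^esub> N)"
    and max: "\<And>U. ?P U \<Longrightarrow> card (rcosets\<^bsub>K\<^esub> U) \<le> card (rcosets\<^bsub>K\<^esub> N)"
    by auto
  let ?N = "K\<lparr>carrier := N\<rparr>" and ?D = "rcosets\<^bsub>K\<^esub> N"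
  have "countable_group ?N"
    using K finite_index_infinite[OF is_group N] subgroup.subgroup_is_group[OF N(1) is_group]
      countable_subset[OF subgroup.subset[OF N(1)]]
    by (simp add: countable_group_def countably_infinite_def)
  moreover have "has_fixed_point ?N X \<phi>"
    if X: "countably_infinite X" and amen: "amenable_action ?N X \<phi>" for X :: "nat set" and \<phi>
  proof (rule ccontr)
    assume nofix: "\<not> has_fixed_point ?N X \<phi>"
    have act: "acts ?N X \<phi>" using amen by (auto simp: amenable_action_def intro: group_action_acts)
    obtain m where m: "invariant_mean ?N X \<phi> m" using amen by (auto simp: amenable_action_def)
    obtain F M where F: "acts K (?D \<times> X) F" and M: "invariant_mean K (?D \<times> X) F M"
      and F1: "\<And>g R x. fst (F g (R, x)) = R #>\<^bsub>K\<^esub> inv\<^bsub>K\<^esub> g"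
      and F2: "\<And>n x. n \<in> N \<Longrightarrow> x \<in> X \<Longrightarrow> F n (N, x) = (N, \<phi> n x)"
      using induced_action[OF is_group N act m] by blast
    have ND: "N \<in> ?D" by (rule subgroup.subgroup_in_rcosets[OF N(1) is_group])
    have "countably_infinite (?D \<times> X)"
      using X N(2) ND by (auto simp: countably_infinite_def finite_cartesian_product_iff countable_finite)
    then obtain R x where Rx: "R \<in> ?D" "x \<in> X" "finite (orbit K F (R, x))"
      using small_orbitsD[OF is_group small _ F M] by auto
    obtain g where g: "g \<in> carrier K" "R #>\<^bsub>K\<^esub> inv\<^bsub>K\<^esub> g = N"
      using rcosets_transitive[OF is_group N(1) Rx(1) ND] by blast
    define y where "y = snd (F g (R, x))"
    have "F g (R, x) = (N, y)" using F1[of g R x] g(2) by (simp add: y_def prod_eq_iff)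
    then have y: "y \<in> X" and orb: "finite (orbit K F (N, y))"
      using acts_closed[OF F g(1), of "(R, x)"] orbit_act[OF F is_group g(1), of "(R, x)"] Rx by auto
    obtain U where "?P U" "card (rcosets\<^bsub>K\<^esub> U) = card (orbit K F (N, y))"
      using orbit_stabilizer_index[OF F is_group _ orb] ND y by blast
    then have le: "card (orbit K F (N, y)) \<le> card ?D" using max by metis
    obtain n where n: "n \<in> N" "\<phi> n y \<noteq> y" using nofix y by (auto simp: has_fixed_point_def)
    have p: "(N, \<phi> n y) \<in> orbit K F (N, y)"
      using F2[OF n(1) y] n(1) subgroup.mem_carrier[OF N(1)] by (force simp: orbit_def)
    \<comment> \<open>The orbit projects onto the cosets, even without one of its two points above \<open>N\<close>.\<close>
    have "?D \<subseteq> fst ` (orbit K F (N, y) - {(N, \<phi> n y)})"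
    proof
      fix R' assume R': "R' \<in> ?D"
      show "R' \<in> fst ` (orbit K F (N, y) - {(N, \<phi> n y)})"
      proof (cases "R' = N")
        case True
        have "(N, y) \<in> orbit K F (N, y)" using orbit_self[OF F is_group] ND y by auto
        then show ?thesis using n(2) True by force
      next
        case False
        obtain h where h: "h \<in> carrier K" "N #>\<^bsub>K\<^esub> inv\<^bsub>K\<^esub> h = R'"
          using rcosets_transitive[OF is_group N(1) ND R'] by blast
        then have "fst (F h (N, y)) = R'" using F1 by simp
        moreover have "F h (N, y) \<in> orbit K F (N, y)" using h(1) by (auto simp: orbit_def)
        ultimately show ?thesis using False by (metis Diff_iff fst_conv image_eqI singletonD)
      qed
    qed
    then have "card ?D \<le> card (orbit K F (N, y) - {(N, \<phi> n y)})"
      using orb by (meson finite_Diff surj_card_le)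
    also have "\<dots> < card (orbit K F (N, y))" using orb p by (rule card_Diff1_less)
    finally show False using le by simp
  qed
  ultimately have "property_F ?N" by (simp add: property_F_def)
  then show ?thesis using K N by (auto simp: virtually_F_def)
qed

lemma virtually_F_finite_orbit:
  assumes VF: "virtually_F K" and X: "countably_infinite X" and act: "acts K X f"
    and m: "invariant_mean K X f m"
  obtains x where "x \<in> X" "finite (orbit K f x)"
proof -
  obtain H where H: "subgroup H K" "finite (rcosets\<^bsub>K\<^esub> H)" "property_F (K\<lparr>carrier := H\<rparr>)"
    and K: "group K"
    using VF by (auto simp: virtually_F_def countable_group_def)
  have "invariant_mean (K\<lparr>carrier := H\<rparr>) X f m"
    using m subgroup.mem_carrier[OF H(1)] by (auto simp: invariant_mean_iff preserves_def)
  then obtain x where x: "x \<in> X" "\<forall>h\<in>H. f h x = x"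
    using property_F_fixed_point[OF H(3) X acts_subgroup[OF act H(1)]] by auto
  then show thesis using that orbit_of_fixed_point(1)[OF act K H(1,2)] by blast
qed

text \<open>A finite orbit of a transitive action is everything, but an infinite group cannot act
  faithfully on a finite set.\<close>

lemma class_A_not_virtually_F:
  assumes "class_A K"
  shows "\<not> virtually_F K"
proof
  assume VF: "virtually_F K"
  obtain X :: "nat set" and \<phi> where faith: "faithful_action K X \<phi>" and trans: "transitive_action K X \<phi>"
    and amen: "amenable_action K X \<phi>" and K: "group K" "infinite (carrier K)"
    using assms by (auto simp: class_A_def countable_group_def countably_infinite_def)
  have act: "acts K X \<phi>" using amen by (auto simp: amenable_action_def intro: group_action_acts)
  obtain m where m: "invariant_mean K X \<phi> m" using amen by (auto simp: amenable_action_def)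
  have "infinite X"
  proof
    assume "finite X"
    then have "finite (X \<rightarrow>\<^sub>E X)" by (simp add: finite_PiE)
    moreover have "\<phi> ` carrier K \<subseteq> X \<rightarrow>\<^sub>E X"
      using group_action.bij_prop0[OF faithful_action.axioms(1)[OF faith]]
      by (auto simp: Bij_def PiE_def Pi_iff bij_betw_def)
    ultimately have "finite (\<phi> ` carrier K)" by (rule finite_subset[rotated])
    then show False
      using faithful_action.faithful[OF faith] K(2) by (simp add: finite_image_iff)
  qed
  then obtain x where x: "x \<in> X" "finite (orbit K \<phi> x)"
    using virtually_F_finite_orbit[OF VF _ act m] by (auto simp: countably_infinite_def)
  moreover have "X \<subseteq> orbit K \<phi> x"
    using transitive_action.unique_orbit[OF trans x(1)] by (force simp: orbit_def)
  ultimately show False using \<open>infinite X\<close> finite_subset by auto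
qed

text \<open>An action violating (F) still has a finite orbit, which is not a single point; it is carried
  over to an initial segment of \<open>\<nat>\<close>.\<close>

lemma virtually_F_not_F_finite_action:
  assumes VF: "virtually_F K" and nF: "\<not> property_F K"
  obtains d :: nat and f where "2 \<le> d" "acts K {..<d} f" "\<And>x. x < d \<Longrightarrow> orbit K f x = {..<d}"
proof -
  have K: "group K" "countable_group K" using VF by (auto simp: virtually_F_def countable_group_def)
  obtain X :: "nat set" and \<phi> where X: "countably_infinite X" "amenable_action K X \<phi>"
    and nofix: "\<not> has_fixed_point K X \<phi>"
    using nF K(2) by (auto simp: property_F_def)
  have act: "acts K X \<phi>" using X(2) by (auto simp: amenable_action_def intro: group_action_acts)
  obtain m where m: "invariant_mean K X \<phi> m" using X(2) by (auto simp: amenable_action_def)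
  obtain x where x: "x \<in> X" "finite (orbit K \<phi> x)"
    by (rule virtually_F_finite_orbit[OF VF X(1) act m])
  let ?O = "orbit K \<phi> x"
  obtain g where g: "g \<in> carrier K" "\<phi> g x \<noteq> x" using nofix x(1) by (auto simp: has_fixed_point_def)
  have "{x, \<phi> g x} \<subseteq> ?O" using g(1) orbit_self[OF act K(1) x(1)] by (auto simp: orbit_def)
  then have "card {x, \<phi> g x} \<le> card ?O" using x(2) by (rule card_mono[rotated])
  then have two: "2 \<le> card ?O" using g(2) by simp
  have OX: "?O \<subseteq> X" by (rule orbit_subset[OF act x(1)])
  have orb: "orbit K \<phi> y = ?O" if "y \<in> ?O" for y
    using that orbit_act[OF act K(1) _ x(1)] by (auto simp: orbit_def[of K \<phi> x])
  have "\<phi> h y \<in> ?O" if "h \<in> carrier K" "y \<in> ?O" for h y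
    using orb[OF that(2)] that(1) by (auto simp: orbit_def[of K \<phi> y])
  then have actO: "acts K ?O \<phi>" by (rule acts_subset[OF act OX])
  obtain b where b: "bij_betw b ?O {..<card ?O}"
    using ex_bij_betw_finite_nat[OF x(2)] by (auto simp: atLeast0LessThan)
  let ?f = "\<lambda>g y. b (\<phi> g (inv_into ?O b y))"
  have "orbit K ?f y = {..<card ?O}" if "y < card ?O" for y
  proof -
    obtain z where z: "z \<in> ?O" "y = b z" using b \<open>y < card ?O\<close> by (auto simp: bij_betw_def)
    then have "orbit K ?f y = b ` orbit K \<phi> z" using orbit_acts_transport[OF b] by simp
    also have "\<dots> = {..<card ?O}" using orb[OF z(1)] b by (simp add: bij_betw_def)
    finally show ?thesis .
  qed
  then show thesis using that[OF two acts_transport[OF actO b]] by blast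
qed


section \<open>Limits of means\<close>

text \<open>Tychonoff's theorem gives the sequence a cluster point in the product of unit intervals;
  restricting the index filter turns the cluster point into a limit.\<close>

lemma bounded_functions_pointwise_limit:
  fixes M :: "nat \<Rightarrow> 'b \<Rightarrow> real"
  assumes "\<And>k A. M k A \<in> {0..1}"
  obtains F \<mu> where "F \<noteq> bot" "F \<le> sequentially" "\<And>A. ((\<lambda>k. M k A) \<longlongrightarrow> \<mu> A) F"
proof -
  have "compactin (product_topology (\<lambda>_. euclidean) UNIV) (UNIV \<rightarrow>\<^sub>E {0..1 :: real} :: ('b \<Rightarrow> real) set)"
    by (simp add: compactin_PiE)
  then have "compact (UNIV \<rightarrow>\<^sub>E {0..1 :: real} :: ('b \<Rightarrow> real) set)"
    by (simp add: euclidean_product_topology)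
  moreover have "filtermap M sequentially \<le> principal (UNIV \<rightarrow>\<^sub>E {0..1})"
    using assms by (simp add: le_principal eventually_filtermap PiE_iff)
  moreover have "filtermap M sequentially \<noteq> bot" by (simp add: filtermap_bot_iff)
  ultimately obtain \<mu> where \<mu>: "inf (nhds \<mu>) (filtermap M sequentially) \<noteq> bot"
    unfolding compact_filter le_principal by (metis (no_types, lifting))
  define F where "F = inf (filtercomap M (nhds \<mu>)) sequentially"
  have "F \<noteq> bot"
  proof
    assume "F = bot"
    then have "eventually (\<lambda>_. False) F" by simp
    then obtain P Q where P: "eventually P (filtercomap M (nhds \<mu>))" and Q: "eventually Q sequentially"
      and PQ: "\<And>k. P k \<Longrightarrow> Q k \<Longrightarrow> False"
      unfolding F_def eventually_inf by blast
    obtain P' where P': "eventually P' (nhds \<mu>)" "\<And>k. P' (M k) \<Longrightarrow> P k"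
      using P by (auto simp: eventually_filtercomap)
    have "eventually (\<lambda>f. \<not> P' f) (filtermap M sequentially)"
      using Q unfolding eventually_filtermap by (rule eventually_mono) (use PQ P'(2) in blast)
    with P'(1) have "eventually (\<lambda>_. False) (inf (nhds \<mu>) (filtermap M sequentially))"
      unfolding eventually_inf by blast
    then show False using \<mu> by (simp add: trivial_limit_def)
  qed
  moreover have "(M \<longlongrightarrow> \<mu>) F"
    unfolding filterlim_iff_le_filtercomap F_def by simp
  then have "((\<lambda>k. M k A) \<longlongrightarrow> \<mu> A) F" for A
  proof (rule filterlim_compose[rotated])
    have "continuous_on UNIV (\<lambda>x :: 'b \<Rightarrow> real. x A)" by (rule continuous_on_product_coordinates)
    then show "((\<lambda>x. x A) \<longlongrightarrow> \<mu> A) (nhds \<mu>)"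
      using tendsto_at_iff_tendsto_nhds[of "\<lambda>x. x A" \<mu>]
      by (simp add: continuous_on_def)
  qed
  moreover have "F \<le> sequentially" by (simp add: F_def)
  ultimately show thesis using that by blast
qed

lemma limit_mean:
  assumes M: "\<And>k. mean_on Z (M k)" and F: "F \<noteq> bot" and lim: "\<And>A. A \<subseteq> Z \<Longrightarrow> ((\<lambda>k. M k A) \<longlongrightarrow> \<mu> A) F"
  shows "mean_on Z \<mu>"
proof -
  have "0 \<le> \<mu> A \<and> \<mu> A \<le> 1" if "A \<subseteq> Z" for A
    using tendsto_lowerbound[OF lim[OF that] _ F, of 0] tendsto_upperbound[OF lim[OF that] _ F, of 1]
      mean_nonneg[OF M that] mean_le_one[OF M that] by simp
  moreover have "\<mu> (A \<union> B) = \<mu> A + \<mu> B" if A: "A \<subseteq> Z" and B: "B \<subseteq> Z" and AB: "A \<inter> B = {}" for A B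
  proof -
    have "((\<lambda>k. M k (A \<union> B)) \<longlongrightarrow> \<mu> A + \<mu> B) F"
      using tendsto_add[OF lim[OF A] lim[OF B]] mean_Un[OF M A B AB] by simp
    moreover have "((\<lambda>k. M k (A \<union> B)) \<longlongrightarrow> \<mu> (A \<union> B)) F" using A B by (intro lim) auto
    ultimately show ?thesis using F by (metis tendsto_unique)
  qed
  moreover have "\<mu> Z = 1"
    using tendsto_unique[OF F lim[OF order_refl], of 1] mean_space[OF M] by simp
  ultimately show ?thesis by (simp add: mean_on_def)
qed

lemma limit_preserves:
  assumes act: "acts G Z f" and ev: "eventually (\<lambda>k. preserves G Z f (M k)) F" and F: "F \<noteq> bot"
    and lim: "\<And>A. A \<subseteq> Z \<Longrightarrow> ((\<lambda>k. M k A) \<longlongrightarrow> \<mu> A) F"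
  shows "preserves G Z f \<mu>"
  unfolding preserves_def
proof (intro ballI allI impI)
  fix g A assume g: "g \<in> carrier G" and A: "A \<subseteq> Z"
  have "f g ` A \<subseteq> Z" using acts_closed[OF act g] A by auto
  moreover have "eventually (\<lambda>k. M k (f g ` A) = M k A) F"
    using ev by (rule eventually_mono) (use g A in \<open>auto simp: preserves_def\<close>)
  ultimately have "((\<lambda>k. M k A) \<longlongrightarrow> \<mu> (f g ` A)) F"
    using lim[of "f g ` A"] tendsto_cong by force
  then show "\<mu> (f g ` A) = \<mu> A" using tendsto_unique[OF F _ lim[OF A]] by blast
qed


section \<open>Modifying an action on a null set\<close>

lemma acts_patch:
  assumes G: "group G" and f: "acts G Z f" and S: "S \<subseteq> Z" and h: "acts G S h"
    and inv: "\<And>g z. g \<in> carrier G \<Longrightarrow> z \<in> S \<Longrightarrow> f g z \<in> S"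
  shows "acts G Z (\<lambda>g z. if z \<in> S then h g z else f g z)"
proof -
  interpret group G by fact
  have notS: "f g z \<notin> S" if g: "g \<in> carrier G" and z: "z \<in> Z" "z \<notin> S" for g z
    using inv[of "inv\<^bsub>G\<^esub> g" "f g z"] acts_inv(1)[OF f G g z(1)] g z(2) by auto
  show ?thesis
    using f h S notS by (intro actsI) (auto simp: acts_def)
qed

lemma preserves_patch:
  assumes f: "acts G Z f" and S: "S \<subseteq> Z" and h: "acts G S h"
    and m: "mean_on Z m" "preserves G Z f m" and null: "m S = 0"
  shows "preserves G Z (\<lambda>g z. if z \<in> S then h g z else f g z) m"
  unfolding preserves_def
proof (intro ballI allI impI)
  fix g A assume g: "g \<in> carrier G" and A: "A \<subseteq> Z"
  let ?n = "\<lambda>z. if z \<in> S then h g z else f g z"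
  have null': "m B = 0" if "B \<subseteq> S" for B
    using mean_mono[OF m(1) that S] mean_nonneg[OF m(1), of B] null that S by auto
  have split: "m B = m C" if "B = C \<union> D" "C \<subseteq> Z" "D \<subseteq> S" for B C D
  proof -
    have "m C \<le> m B" using that S by (intro mean_mono[OF m(1)]) auto
    moreover have "m B \<le> m C + m D" using that S mean_subadditive[OF m(1), of C D] by auto
    ultimately show ?thesis using null'[OF that(3)] by simp
  qed
  have fA: "f g ` (A - S) \<subseteq> Z" using acts_closed[OF f g] A by auto
  have "?n ` A = f g ` (A - S) \<union> h g ` (A \<inter> S)" by auto
  then have "m (?n ` A) = m (f g ` (A - S))"
    using acts_closed[OF h g] fA by (intro split) auto
  also have "\<dots> = m (A - S)" using m(2) g A by (simp add: preserves_def subset_trans[OF Diff_subset])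
  also have "\<dots> = m A" using A by (intro split[symmetric, of A "A - S" "A \<inter> S"]) auto
  finally show "m (?n ` A) = m A" .
qed

lemma ex_bij_betw_countably_infinite:
  assumes "countably_infinite A" "countably_infinite B"
  obtains b where "bij_betw b A B"
  using bij_betw_trans[OF to_nat_on_infinite[of A] bij_betw_from_nat_into[of B]] assms
  by (auto simp: countably_infinite_def)


section \<open>Actions of free products\<close>

context
  fixes I :: "'i set" and G :: "'i \<Rightarrow> ('a, 'm) monoid_scheme"
  assumes grp: "\<And>i. i \<in> I \<Longrightarrow> group (G i)"
begin

lemma fp_inj_closed: "i \<in> I \<Longrightarrow> x \<in> carrier (G i) \<Longrightarrow> fp_inj I G i x \<in> carrier (free_product I G)"
  using fp_inj_hom[of I G i] grp by (auto simp: hom_def)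

lemma fp_induct [consumes 1, case_names one mult]:
  assumes "p \<in> carrier (free_product I G)"
    and one: "Q \<one>\<^bsub>free_product I G\<^esub>"
    and mult: "\<And>i x q. \<lbrakk>i \<in> I; x \<in> carrier (G i); q \<in> carrier (free_product I G); Q q\<rbrakk>
      \<Longrightarrow> Q (fp_inj I G i x \<otimes>\<^bsub>free_product I G\<^esub> q)"
  shows "Q p"
proof -
  obtain w where w: "w \<in> fp_words I G" "p = fp_rel I G `` {w}"
    using fp_carrier_cases[OF grp assms(1)] by blast
  have "Q (fp_rel I G `` {w})" using w(1)
  proof (induction w)
    case Nil
    then show ?case using one fp_one[of I G, OF grp] by simp
  next
    case (Cons a w)
    obtain i x where a: "a = (i, x)" "i \<in> I" "x \<in> carrier (G i)" "w \<in> fp_words I G"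
      using Cons.prems by (cases a) auto
    have "fp_rel I G `` {a # w} = fp_inj I G i x \<otimes>\<^bsub>free_product I G\<^esub> fp_rel I G `` {w}"
      using fp_mult[where I = I and G = G and u = "[a]" and v = w, OF grp] a by (simp add: fp_inj_def)
    then show ?case using mult a fp_class_closed[OF grp a(4)] Cons.IH by simp
  qed
  with w show ?thesis by simp
qed

lemma acts_factor:
  assumes "acts (free_product I G) X F" "i \<in> I"
  shows "acts (G i) X (\<lambda>x. F (fp_inj I G i x))"
  using assms grp by (intro acts_hom[OF _ fp_inj_hom] free_product_group) auto

text \<open>The universal property, applied to the group of bijections of \<open>X\<close>.\<close>

lemma free_product_acts:
  assumes "\<And>i. i \<in> I \<Longrightarrow> acts (G i) X (f i)"
  obtains F where "acts (free_product I G) X F"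
    "\<And>i g x. i \<in> I \<Longrightarrow> g \<in> carrier (G i) \<Longrightarrow> x \<in> X \<Longrightarrow> F (fp_inj I G i g) x = f i g x"
proof -
  have "(\<lambda>g. restrict (f i g) X) \<in> hom (G i) (BijGroup X)" if "i \<in> I" for i
    using acts_group_action[OF assms[OF that] grp[OF that]]
    by (simp add: group_action_def group_hom_def group_hom_axioms_def)
  then obtain F where F: "F \<in> hom (free_product I G) (BijGroup X)"
    "\<forall>i\<in>I. \<forall>g\<in>carrier (G i). F (fp_inj I G i g) = restrict (f i g) X"
    using free_product_universal(1)[of I G "BijGroup X" "\<lambda>i g. restrict (f i g) X", OF grp group_BijGroup]
    by blast
  have "group_action (free_product I G) X F"
    using F(1) free_product_group[of I G, OF grp] group_BijGroup
    by (simp add: group_action_def group_hom_def group_hom_axioms_def)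
  then show thesis using that[of F] F(2) by (simp add: group_action_acts)
qed

lemma free_product_preserves:
  assumes act: "acts (free_product I G) X F"
    and pres: "\<And>i. i \<in> I \<Longrightarrow> preserves (G i) X (\<lambda>g. F (fp_inj I G i g)) m"
  shows "preserves (free_product I G) X F m"
  unfolding preserves_def
proof (intro ballI allI impI)
  fix p A assume "p \<in> carrier (free_product I G)" and A: "A \<subseteq> X"
  then show "m (F p ` A) = m A"
  proof (induction p rule: fp_induct)
    case one
    have "F \<one>\<^bsub>free_product I G\<^esub> ` A = A" using acts_one[OF act] A by force
    then show ?case by simp
  next
    case (mult i x q)
    have "F (fp_inj I G i x \<otimes>\<^bsub>free_product I G\<^esub> q) ` A = F (fp_inj I G i x) ` F q ` A"
      using acts_mult[OF act fp_inj_closed[OF mult(1,2)] mult(3)] A unfolding image_image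
      by (intro image_cong) auto
    moreover have "F q ` A \<subseteq> X" using acts_closed[OF act mult(3)] A by auto
    ultimately show ?case using pres[OF mult(1)] mult A by (simp add: preserves_def)
  qed
qed

lemma free_product_orbit_subset:
  assumes act: "acts (free_product I G) X F" and x: "x \<in> R" and R: "R \<subseteq> X"
    and closed: "\<And>i g y. i \<in> I \<Longrightarrow> g \<in> carrier (G i) \<Longrightarrow> y \<in> R \<Longrightarrow> F (fp_inj I G i g) y \<in> R"
  shows "orbit (free_product I G) F x \<subseteq> R"
proof -
  have "F p x \<in> R" if "p \<in> carrier (free_product I G)" for p
    using that
  proof (induction p rule: fp_induct)
    case one
    then show ?case using acts_one[OF act] x R by auto
  next
    case (mult i g q)
    then show ?case
      using acts_mult[OF act fp_inj_closed[OF mult(1,2)] mult(3)] closed x R by auto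
  qed
  then show ?thesis by (auto simp: orbit_def)
qed

text \<open>Killing all other factors retracts the free product onto \<open>G j\<close>.  This separates the elements
  of one factor from each other and from those of the other factors, without normal forms.\<close>

lemma free_product_retraction:
  assumes j: "j \<in> I"
  obtains \<pi> where "\<pi> \<in> hom (free_product I G) (G j)"
    "\<And>x. x \<in> carrier (G j) \<Longrightarrow> \<pi> (fp_inj I G j x) = x"
    "\<And>i x. i \<in> I \<Longrightarrow> i \<noteq> j \<Longrightarrow> x \<in> carrier (G i) \<Longrightarrow> \<pi> (fp_inj I G i x) = \<one>\<^bsub>G j\<^esub>"
proof -
  interpret group "G j" using grp[OF j] .
  let ?h = "\<lambda>i x. if i = j then x else \<one>\<^bsub>G j\<^esub>"
  have "?h i \<in> hom (G i) (G j)" if "i \<in> I" for i by (auto simp: hom_def)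
  then obtain \<pi> where "\<pi> \<in> hom (free_product I G) (G j)"
    "\<forall>i\<in>I. \<forall>x\<in>carrier (G i). \<pi> (fp_inj I G i x) = ?h i x"
    using free_product_universal(1)[of I G "G j" ?h, OF grp is_group] by blast
  then show thesis using that[of \<pi>] j by simp
qed

lemma fp_inj_inj_on:
  assumes "j \<in> I"
  shows "inj_on (fp_inj I G j) (carrier (G j))"
proof -
  obtain \<pi> where "\<And>x. x \<in> carrier (G j) \<Longrightarrow> \<pi> (fp_inj I G j x) = x"
    using free_product_retraction[OF assms] by metis
  then show ?thesis by (rule inj_on_inverseI)
qed

lemma free_product_countable_group:
  assumes "countable I" "I \<noteq> {}" "\<And>i. i \<in> I \<Longrightarrow> countable_group (G i)"
  shows "countable_group (free_product I G)"
proof -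
  have "countable (SIGMA i:I. carrier (G i))"
    using assms by (intro countable_SIGMA) (auto simp: countable_group_def countably_infinite_def)
  then have "countable (fp_words I G)" by (simp add: fp_words_def)
  then have "countable (carrier (free_product I G))"
    by (auto simp: free_product_def quotient_def)
  moreover obtain j where j: "j \<in> I" using assms(2) by auto
  have "infinite (fp_inj I G j ` carrier (G j))"
    using assms(3)[OF j] fp_inj_inj_on[OF j]
    by (simp add: finite_image_iff countable_group_def countably_infinite_def)
  then have "infinite (carrier (free_product I G))"
    using fp_inj_closed[OF j] by (meson finite_subset image_subsetI)
  ultimately show ?thesis
    using free_product_group[of I G, OF grp] by (simp add: countable_group_def countably_infinite_def)
qed

text \<open>Almost every point is fixed by a subgroup \<open>H\<close> of finite index in \<open>G j\<close>, and has translates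
  under the finitely many representatives of \<open>H\<close> in \<open>G j\<close> that are fixed by all factors with
  property (F).  These translates form the \<open>G j\<close>-orbit of the point, which is thus invariant under
  all factors.\<close>

lemma free_product_virtually_F:
  assumes fin: "finite I" and j: "j \<in> I" and VF: "virtually_F (G j)"
    and F: "\<And>i. i \<in> I \<Longrightarrow> i \<noteq> j \<Longrightarrow> property_F (G i)"
  shows "virtually_F (free_product I G)"
proof -
  let ?P = "free_product I G"
  interpret Gj: group "G j" using grp[OF j] .
  obtain H where H: "subgroup H (G j)" "finite (rcosets\<^bsub>G j\<^esub> H)" and HF: "property_F ((G j)\<lparr>carrier := H\<rparr>)"
    using VF by (auto simp: virtually_F_def)
  have "countable_group (G i)" if "i \<in> I" for i
    using VF F[OF that] by (cases "i = j") (auto simp: virtually_F_def property_F_def)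
  then have P: "countable_group ?P"
    using fin j by (intro free_product_countable_group) (auto simp: countable_finite)
  have "small_orbits ?P (card (rcosets\<^bsub>G j\<^esub> H))"
    unfolding small_orbits_def
  proof (intro allI impI)
    fix X :: "nat set" and f m
    assume X: "countably_infinite X" and act: "acts ?P X f" and m: "invariant_mean ?P X f m"
    have mX: "mean_on X m" using m by (simp add: invariant_mean_iff)
    have Xc: "countable X" using X by (simp add: countably_infinite_def)
    let ?f = "\<lambda>i g. f (fp_inj I G i g)"
    have acti: "acts (G i) X (?f i)" if "i \<in> I" for i by (rule acts_factor[OF act that])
    have mi: "invariant_mean (G i) X (?f i) m" if "i \<in> I" for i
      using m fp_inj_closed[OF that] by (simp add: invariant_mean_iff preserves_def)
    define Fix where "Fix i = {x \<in> X. \<forall>g\<in>carrier (G i). ?f i g x = x}" for i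
    have Fix: "m (Fix i) = 1" if "i \<in> I" "i \<noteq> j" for i
      unfolding Fix_def by (rule property_F_fixed_points_full[OF F[OF that] Xc acti mi]) fact+
    define FH where "FH = {x \<in> X. \<forall>h\<in>H. ?f j h x = x}"
    have "invariant_mean ((G j)\<lparr>carrier := H\<rparr>) X (?f j) m"
      using mi[OF j] subgroup.mem_carrier[OF H(1)] by (auto simp: invariant_mean_iff preserves_def)
    then have FH: "m FH = 1"
      using property_F_fixed_points_full[OF HF Xc acts_subgroup[OF acti[OF j] H(1)]]
      by (simp add: FH_def)
    \<comment> \<open>Representatives of the cosets \<open>g H\<close>.\<close>
    define r where "r R = inv\<^bsub>G j\<^esub> (SOME y. y \<in> R)" for R
    have r: "r R \<in> carrier (G j)" if "R \<in> rcosets\<^bsub>G j\<^esub> H" for R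
    proof -
      have "(SOME y. y \<in> R) \<in> R"
        using subgroup.rcosets_non_empty[OF H(1) that] by (simp add: some_in_eq)
      then show ?thesis
        using subgroup.rcosets_carrier[OF H(1) Gj.is_group that] by (auto simp: r_def)
    qed
    let ?B = "{x \<in> X. \<forall>(R, i)\<in>(rcosets\<^bsub>G j\<^esub> H) \<times> (I - {j}). x \<in> {x \<in> X. ?f j (r R) x \<in> Fix i}}"
    have "m ?B = 1"
      unfolding case_prod_unfold
    proof (rule mean_full_Int[OF mX])
      fix p assume p: "p \<in> (rcosets\<^bsub>G j\<^esub> H) \<times> (I - {j})"
      let ?g = "r (fst p)" and ?A = "{x \<in> X. ?f j (r (fst p)) x \<in> Fix (snd p)}"
      have g: "?g \<in> carrier (G j)" using r p by auto
      have "?f j ?g ` ?A = Fix (snd p)"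
        using acts_surj[OF acti[OF j] Gj.is_group g] by (auto simp: Fix_def)
      then have "m ?A = m (Fix (snd p))"
        using mi[OF j] g unfolding invariant_mean_iff preserves_def by (metis (no_types, lifting) mem_Collect_eq subsetI)
      moreover have "snd p \<in> I" "snd p \<noteq> j" using p by auto
      ultimately show "m ?A = 1" using Fix by simp
    qed (use H(2) fin in auto)
    then have "m (FH \<inter> ?B) = 1"
      using mean_full_Int[OF mX, of "{FH, ?B}" "\<lambda>A. A"] FH
      by (auto simp: FH_def Int_def conj_ac cong: conj_cong)
    moreover have "m {} = 0" by (rule mean_empty[OF mX])
    ultimately have "FH \<inter> ?B \<noteq> {}" by (metis zero_neq_one)
    then obtain x where x: "x \<in> FH" "x \<in> ?B" by blast
    then have xX: "x \<in> X" by simp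
    have fixH: "?f j h x = x" if "h \<in> H" for h using x(1) that by (simp add: FH_def)
    let ?O = "orbit (G j) (?f j) x"
    have OX: "?O \<subseteq> X" by (rule orbit_subset[OF acti[OF j] xX])
    have small: "finite ?O" "card ?O \<le> card (rcosets\<^bsub>G j\<^esub> H)"
      using orbit_of_fixed_point[OF acti[OF j] Gj.is_group H xX fixH] by auto
    have "orbit ?P f x \<subseteq> ?O"
    proof (rule free_product_orbit_subset[OF act _ OX])
      show "x \<in> ?O" by (rule orbit_self[OF acti[OF j] Gj.is_group xX])
      fix i g y assume i: "i \<in> I" and g: "g \<in> carrier (G i)" and y: "y \<in> ?O"
      obtain h where h: "h \<in> carrier (G j)" "y = ?f j h x" using y by (auto simp: orbit_def)
      show "?f i g y \<in> ?O"
      proof (cases "i = j")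
        case True
        then have "?f i g y = ?f j (g \<otimes>\<^bsub>G j\<^esub> h) x"
          using acts_mult[OF acti[OF j] _ h(1) xX] g h(2) by simp
        then show ?thesis using g h(1) True by (auto simp: orbit_def)
      next
        case False
        let ?R = "H #>\<^bsub>G j\<^esub> inv\<^bsub>G j\<^esub> h"
        have R: "?R \<in> rcosets\<^bsub>G j\<^esub> H"
          using h(1) subgroup.subset[OF H(1)] by (intro Gj.rcosetsI) auto
        have "inv\<^bsub>G j\<^esub> h \<in> ?R" using h(1) H(1) by (intro Gj.rcos_self) auto
        then have "(SOME r. r \<in> ?R) \<in> ?R" by (rule someI)
        then obtain a where a: "a \<in> H" "(SOME r. r \<in> ?R) = a \<otimes>\<^bsub>G j\<^esub> inv\<^bsub>G j\<^esub> h"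
          by (auto simp: r_coset_def)
        note ac = subgroup.mem_carrier[OF H(1) a(1)]
        have "r ?R = h \<otimes>\<^bsub>G j\<^esub> inv\<^bsub>G j\<^esub> a"
          using a(2) h(1) ac by (simp add: r_def Gj.inv_mult_group)
        then have "?f j (r ?R) x = y"
          using acts_mult[OF acti[OF j] h(1) _ xX, of "inv\<^bsub>G j\<^esub> a"] ac h(2)
            fixH[OF subgroup.m_inv_closed[OF H(1) a(1)]] by simp
        then have "y \<in> Fix i" using x(2) R i False by auto
        then show ?thesis using g y by (simp add: Fix_def)
      qed
    qed
    then have "finite (orbit ?P f x)" "card (orbit ?P f x) \<le> card ?O"
      using small(1) by (auto intro: finite_subset card_mono)
    then show "\<exists>x\<in>X. finite (orbit ?P f x) \<and> card (orbit ?P f x) \<le> card (rcosets\<^bsub>G j\<^esub> H)"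
      using xX small(2) by (meson le_trans)
  qed
  with P show ?thesis by (rule small_orbits_virtually_F)
qed


section \<open>Constructing faithful transitive amenable actions\<close>

text \<open>Let all factors act on \<open>Z\<close>, the disjoint union of the sets \<open>Y k\<close> and of the free product
  itself; the limit of the means \<open>m k\<close> is an invariant mean on \<open>Z\<close>.  The set \<open>S\<close>, formed by the
  sets \<open>T k\<close> and by the subgroup \<open>G i0\<close> of the free product, is null and \<open>G i0\<close>-invariant.
  Replacing the action of \<open>G i0\<close> on \<open>S\<close> by a regular one, and changing nothing else, preserves the
  mean and connects all points, because every orbit meets \<open>S\<close>.  The action is faithful since a
  given element still acts by left multiplication on every point of the free product outside
  finitely many translates of \<open>G i0\<close>; such points exist because \<open>G j\<close> is infinite.\<close>

theorem free_product_class_A: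
  fixes Y T :: "nat \<Rightarrow> 'y set"
  assumes I: "countable I" and cG: "\<And>i. i \<in> I \<Longrightarrow> countable_group (G i)"
    and i0: "i0 \<in> I" and j: "j \<in> I" "j \<noteq> i0"
    and Y: "\<And>k i. i \<in> I \<Longrightarrow> acts (G i) (Y k) (f k i)"
    and mean: "\<And>k. mean_on (Y k) (m k)"
    and pres: "\<And>i. i \<in> I \<Longrightarrow> eventually (\<lambda>k. preserves (G i) (Y k) (f k i) (m k)) sequentially"
    and T: "\<And>k. T k \<subseteq> Y k" "\<And>k. countable (T k)"
      "\<And>k g t. g \<in> carrier (G i0) \<Longrightarrow> t \<in> T k \<Longrightarrow> f k i0 g t = t"
    and connected: "\<And>k R. T k \<subseteq> R \<Longrightarrow> R \<subseteq> Y k \<Longrightarrow>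
      (\<And>i g y. i \<in> I \<Longrightarrow> g \<in> carrier (G i) \<Longrightarrow> y \<in> R \<Longrightarrow> f k i g y \<in> R) \<Longrightarrow> Y k \<subseteq> R"
    and null: "(\<lambda>k. m k (T k)) \<longlonglongrightarrow> 0"
  shows "class_A (free_product I G)"
proof -
  let ?P = "free_product I G" and ?\<iota> = "fp_inj I G"
  interpret P: group ?P by (rule free_product_group[OF grp])
  interpret G0: group "G i0" using grp[OF i0] .
  note \<iota>c = fp_inj_closed
  have \<iota>m: "?\<iota> i (g \<otimes>\<^bsub>G i\<^esub> h) = ?\<iota> i g \<otimes>\<^bsub>?P\<^esub> ?\<iota> i h"
    if "i \<in> I" "g \<in> carrier (G i)" "h \<in> carrier (G i)" for i g h
    using fp_inj_hom[of I G i, OF grp that(1)] that by (auto simp: hom_def)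
  have \<iota>1: "?\<iota> i \<one>\<^bsub>G i\<^esub> = \<one>\<^bsub>?P\<^esub>" if "i \<in> I" for i
    using hom_one[OF fp_inj_hom[of I G i, OF grp that] grp[OF that] P.is_group] .

  define Z :: "((nat \<times> 'y) + ('i \<times> 'a) list set) set"
    where "Z = Inl ` (SIGMA k:UNIV. Y k) \<union> Inr ` carrier ?P"
  define O0 where "O0 = ?\<iota> i0 ` carrier (G i0)"
  define S :: "((nat \<times> 'y) + ('i \<times> 'a) list set) set"
    where "S = Inl ` (SIGMA k:UNIV. T k) \<union> Inr ` O0"
  define old where "old i g z = (case z of Inl (k, y) \<Rightarrow> Inl (k, f k i g y) | Inr p \<Rightarrow> Inr (?\<iota> i g \<otimes>\<^bsub>?P\<^esub> p))"
    for i g and z :: "(nat \<times> 'y) + ('i \<times> 'a) list set"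
  have O0: "O0 \<subseteq> carrier ?P" using \<iota>c[OF i0] by (auto simp: O0_def)
  have SZ: "S \<subseteq> Z" using T(1) O0 by (auto simp: S_def Z_def)
  have old: "acts (G i) Z (old i)" if i: "i \<in> I" for i
  proof (rule actsI)
    interpret Gi: group "G i" using grp[OF i] .
    fix z assume "z \<in> Z"
    then consider k y where "z = Inl (k, y)" "y \<in> Y k" | p where "z = Inr p" "p \<in> carrier ?P"
      by (auto simp: Z_def)
    note cs = this
    show "old i g z \<in> Z" if "g \<in> carrier (G i)" for g
      using cs by cases (use that \<iota>c[OF i] acts_closed[OF Y[OF i]] in \<open>auto simp: old_def Z_def\<close>)
    show "old i \<one>\<^bsub>G i\<^esub> z = z"
      using cs by cases (use \<iota>1[OF i] acts_one[OF Y[OF i]] in \<open>auto simp: old_def\<close>)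
    show "old i (g \<otimes>\<^bsub>G i\<^esub> h) z = old i g (old i h z)" if "g \<in> carrier (G i)" "h \<in> carrier (G i)" for g h
      using cs
      by cases (use that \<iota>c[OF i] \<iota>m[OF i] acts_mult[OF Y[OF i]] in \<open>auto simp: old_def P.m_assoc\<close>)
  qed
  have Sinv: "old i0 g z \<in> S" if g: "g \<in> carrier (G i0)" and z: "z \<in> S" for g z
  proof -
    have "?\<iota> i0 g \<otimes>\<^bsub>?P\<^esub> p \<in> O0" if "p \<in> O0" for p
      using that g \<iota>m[OF i0 g] by (force simp: O0_def)
    then show ?thesis using z T(3)[OF g] by (auto simp: S_def old_def)
  qed
  have "countably_infinite S"
  proof -
    have "infinite O0"
      using cG[OF i0] fp_inj_inj_on[OF i0]
      by (simp add: O0_def finite_image_iff countable_group_def countably_infinite_def)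
    then have "infinite S" by (auto simp: S_def finite_image_iff)
    moreover have "countable O0"
      using cG[OF i0] by (simp add: O0_def countable_group_def countably_infinite_def)
    then have "countable S" using T(2) by (simp add: S_def countable_SIGMA)
    ultimately show ?thesis by (simp add: countably_infinite_def)
  qed
  then obtain b where b: "bij_betw b (carrier (G i0)) S"
    using ex_bij_betw_countably_infinite cG[OF i0] by (auto simp: countable_group_def)
  define reg where "reg g z = b (g \<otimes>\<^bsub>G i0\<^esub> inv_into (carrier (G i0)) b z)" for g z
  have reg: "acts (G i0) S reg"
    unfolding reg_def by (rule acts_transport[OF acts_on_itself[OF G0.is_group] b])
  define new where "new i = (if i = i0 then (\<lambda>g z. if z \<in> S then reg g z else old i0 g z) else old i)" for i
  have new: "acts (G i) Z (new i)" if "i \<in> I" for i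
    using acts_patch[OF G0.is_group old[OF i0] SZ reg Sinv] old[OF that] by (simp add: new_def)
  obtain F where F: "acts ?P Z F"
    and F\<iota>: "\<And>i g z. i \<in> I \<Longrightarrow> g \<in> carrier (G i) \<Longrightarrow> z \<in> Z \<Longrightarrow> F (?\<iota> i g) z = new i g z"
    using free_product_acts[of Z new, OF new] by blast

  have "\<exists>\<mu>. invariant_mean ?P Z F \<mu>"
  proof -
    define M where "M k A = m k {y \<in> Y k. Inl (k, y) \<in> A}" for k and A :: "((nat \<times> 'y) + ('i \<times> 'a) list set) set"
    have "M k A \<in> {0..1}" for k A
      using mean_nonneg[OF mean] mean_le_one[OF mean] by (auto simp: M_def)
    then obtain U \<mu> where U: "U \<noteq> bot" "U \<le> sequentially" and lim: "\<And>A. ((\<lambda>k. M k A) \<longlongrightarrow> \<mu> A) U"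
      using bounded_functions_pointwise_limit[of M] by metis
    have Inl_Z: "(\<lambda>y. Inl (k, y)) ` Y k \<subseteq> Z" for k by (auto simp: Z_def)
    have "mean_on Z (M k)" for k
      unfolding M_def by (rule mean_pushforward[OF mean Inl_Z])
    then have \<mu>: "mean_on Z \<mu>" using limit_mean[of Z M U \<mu>] U(1) lim by blast
    have old_\<mu>: "preserves (G i) Z (old i) \<mu>" if i: "i \<in> I" for i
    proof (rule limit_preserves[OF old[OF i] _ U(1)])
      have "preserves (G i) Z (old i) (M k)" if "preserves (G i) (Y k) (f k i) (m k)" for k
        unfolding M_def
        by (rule preserves_pushforward[OF grp[OF i] Y[OF i] old[OF i] that Inl_Z]) (simp add: old_def)
      then show "eventually (\<lambda>k. preserves (G i) Z (old i) (M k)) U"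
        using filter_leD[OF U(2) pres[OF i]] by (auto elim: eventually_mono)
      show "((\<lambda>k. M k A) \<longlongrightarrow> \<mu> A) U" for A by (rule lim)
    qed
    have "{y \<in> Y k. Inl (k, y) \<in> S} = T k" for k using T(1) by (auto simp: S_def)
    then have "((\<lambda>k. M k S) \<longlongrightarrow> 0) U" using tendsto_mono[OF U(2) null] by (simp add: M_def)
    then have "\<mu> S = 0" using tendsto_unique[OF U(1) lim] by blast
    then have "preserves (G i) Z (new i) \<mu>" if "i \<in> I" for i
      using preserves_patch[OF old[OF i0] SZ reg \<mu> old_\<mu>[OF i0]] old_\<mu>[OF that] by (simp add: new_def)
    then have "preserves (G i) Z (\<lambda>g. F (?\<iota> i g)) \<mu>" if "i \<in> I" for i
      using F\<iota>[OF that] that unfolding preserves_def by (metis (no_types, lifting) image_cong subset_iff)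
    then have "preserves ?P Z F \<mu>" by (rule free_product_preserves[OF F])
    with \<mu> show ?thesis by (auto simp: invariant_mean_iff)
  qed
  then have amen: "amenable_action ?P Z (\<lambda>p. restrict (F p) Z)"
    using acts_amenable[OF F P.is_group] by blast

  define s where "s = b \<one>\<^bsub>G i0\<^esub>"
  have s: "s \<in> S" "s \<in> Z" using b SZ by (auto simp: s_def bij_betw_def)
  let ?R = "orbit ?P F s"
  have RZ: "?R \<subseteq> Z" by (rule orbit_subset[OF F s(2)])
  have R_new: "new i g z \<in> ?R" if i: "i \<in> I" and g: "g \<in> carrier (G i)" and z: "z \<in> ?R" for i g z
  proof -
    obtain p where p: "p \<in> carrier ?P" "z = F p s" using z by (auto simp: orbit_def)
    have "new i g z = F (?\<iota> i g) z" using F\<iota>[OF i g] z RZ by auto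
    also have "\<dots> = F (?\<iota> i g \<otimes>\<^bsub>?P\<^esub> p) s" using acts_mult[OF F \<iota>c[OF i g] p(1) s(2)] p(2) by simp
    finally show ?thesis using \<iota>c[OF i g] p(1) by (auto simp: orbit_def)
  qed
  have SR: "S \<subseteq> ?R"
  proof
    fix z assume "z \<in> S"
    then obtain g where g: "g \<in> carrier (G i0)" "z = b g" using b by (auto simp: bij_betw_def)
    have "inv_into (carrier (G i0)) b s = \<one>\<^bsub>G i0\<^esub>" using b by (simp add: s_def bij_betw_def)
    then have "new i0 g s = z" using g s(1) by (simp add: new_def reg_def)
    then show "z \<in> ?R" using R_new[OF i0 g(1) orbit_self[OF F P.is_group s(2)]] by simp
  qed
  have R_old: "old i g z \<in> ?R" if "i \<in> I" "g \<in> carrier (G i)" "z \<in> ?R" for i g z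
  proof (cases "i = i0 \<and> z \<in> S")
    case True
    then show ?thesis using Sinv that SR by auto
  next
    case False
    then have "new i g z = old i g z" by (auto simp: new_def)
    then show ?thesis using R_new[OF that] by simp
  qed
  have "Inl (k, y) \<in> ?R" if "y \<in> Y k" for k y
  proof -
    have "Y k \<subseteq> {y \<in> Y k. Inl (k, y) \<in> ?R}"
    proof (rule connected)
      show "T k \<subseteq> {y \<in> Y k. Inl (k, y) \<in> ?R}" using T(1) SR by (auto simp: S_def)
      fix i g y assume "i \<in> I" "g \<in> carrier (G i)" "y \<in> {y \<in> Y k. Inl (k, y) \<in> ?R}"
      then show "f k i g y \<in> {y \<in> Y k. Inl (k, y) \<in> ?R}"
        using R_old[of i g "Inl (k, y)"] acts_closed[OF Y] by (simp add: old_def)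
    qed auto
    then show ?thesis using that by auto
  qed
  moreover have "Inr p \<in> ?R" if "p \<in> carrier ?P" for p
    using that
  proof (induction p rule: fp_induct)
    case one
    have "\<one>\<^bsub>?P\<^esub> \<in> O0" using \<iota>1[OF i0] by (auto simp: O0_def intro: rev_image_eqI)
    then show ?case using SR by (auto simp: S_def)
  next
    case (mult i x q)
    then show ?case using R_old[of i x "Inr q"] by (simp add: old_def)
  qed
  ultimately have R: "?R = Z" using RZ by (auto simp: Z_def)
  have trans: "\<exists>p\<in>carrier ?P. F p x = y" if "x \<in> Z" "y \<in> Z" for x y
  proof -
    obtain p where "p \<in> carrier ?P" "x = F p s" using \<open>x \<in> Z\<close> R by (auto simp: orbit_def)
    then have "orbit ?P F x = Z" using orbit_act[OF F P.is_group _ s(2)] R by simp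
    then show ?thesis using \<open>y \<in> Z\<close> by (auto simp: orbit_def)
  qed

  define avoids where "avoids C x \<longleftrightarrow> (\<forall>c\<in>C. \<forall>u\<in>O0. x \<noteq> c \<otimes>\<^bsub>?P\<^esub> u)" for C x
  have left_mult: "\<exists>C. finite C \<and> C \<subseteq> carrier ?P \<and>
      (\<forall>x\<in>carrier ?P. avoids C x \<longrightarrow> F p (Inr x) = Inr (p \<otimes>\<^bsub>?P\<^esub> x))"
    if "p \<in> carrier ?P" for p
    using that
  proof (induction p rule: fp_induct)
    case one
    then show ?case using acts_one[OF F] by (intro exI[of _ "{}"]) (auto simp: Z_def)
  next
    case (mult i g q)
    then obtain C where C: "finite C" "C \<subseteq> carrier ?P" and CF:
      "\<And>x. x \<in> carrier ?P \<Longrightarrow> avoids C x \<Longrightarrow> F q (Inr x) = Inr (q \<otimes>\<^bsub>?P\<^esub> x)"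
      by blast
    let ?C = "insert (inv\<^bsub>?P\<^esub> q) C"
    have "F (?\<iota> i g \<otimes>\<^bsub>?P\<^esub> q) (Inr x) = Inr (?\<iota> i g \<otimes>\<^bsub>?P\<^esub> q \<otimes>\<^bsub>?P\<^esub> x)"
      if x: "x \<in> carrier ?P" and notin: "avoids ?C x" for x
    proof -
      have notin': "avoids C x" using notin by (simp add: avoids_def)
      have "q \<otimes>\<^bsub>?P\<^esub> x \<notin> O0"
      proof
        assume "q \<otimes>\<^bsub>?P\<^esub> x \<in> O0"
        moreover have "x = inv\<^bsub>?P\<^esub> q \<otimes>\<^bsub>?P\<^esub> (q \<otimes>\<^bsub>?P\<^esub> x)"
          using mult(3) x by (simp add: P.m_assoc[symmetric])
        ultimately show False using notin unfolding avoids_def by blast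
      qed
      then have "Inr (q \<otimes>\<^bsub>?P\<^esub> x) \<notin> S" by (auto simp: S_def)
      then have "new i g (Inr (q \<otimes>\<^bsub>?P\<^esub> x)) = Inr (?\<iota> i g \<otimes>\<^bsub>?P\<^esub> (q \<otimes>\<^bsub>?P\<^esub> x))"
        by (auto simp: new_def old_def)
      moreover have "F (?\<iota> i g \<otimes>\<^bsub>?P\<^esub> q) (Inr x) = F (?\<iota> i g) (F q (Inr x))"
        using x by (intro acts_mult[OF F \<iota>c[OF mult(1,2)] mult(3)]) (simp add: Z_def)
      moreover have "Inr (q \<otimes>\<^bsub>?P\<^esub> x) \<in> Z" using mult(3) x by (simp add: Z_def)
      ultimately show ?thesis
        using CF[OF x] notin' F\<iota>[OF mult(1,2)] \<iota>c[OF mult(1,2)] mult(3) x by (simp add: P.m_assoc)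
    qed
    then show ?case using C mult(3) by (intro exI[of _ ?C]) auto
  qed
  have faithful: "p = q" if p: "p \<in> carrier ?P" and q: "q \<in> carrier ?P" and eq: "\<And>z. z \<in> Z \<Longrightarrow> F p z = F q z" for p q
  proof -
    obtain C C' where C: "finite C" "C \<subseteq> carrier ?P"
        "\<And>x. x \<in> carrier ?P \<Longrightarrow> avoids C x \<Longrightarrow> F p (Inr x) = Inr (p \<otimes>\<^bsub>?P\<^esub> x)"
      and C': "finite C'" "C' \<subseteq> carrier ?P"
        "\<And>x. x \<in> carrier ?P \<Longrightarrow> avoids C' x \<Longrightarrow> F q (Inr x) = Inr (q \<otimes>\<^bsub>?P\<^esub> x)"
      using left_mult[OF p] left_mult[OF q] by blast
    obtain \<pi> where \<pi>: "\<pi> \<in> hom ?P (G j)" "\<And>x. x \<in> carrier (G j) \<Longrightarrow> \<pi> (?\<iota> j x) = x"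
      "\<And>i x. i \<in> I \<Longrightarrow> i \<noteq> j \<Longrightarrow> x \<in> carrier (G i) \<Longrightarrow> \<pi> (?\<iota> i x) = \<one>\<^bsub>G j\<^esub>"
      using free_product_retraction[OF j(1)] by blast
    interpret Gj: group "G j" using grp[OF j(1)] .
    \<comment> \<open>The retraction is constant on each coset \<open>c O0\<close>, hence takes only finitely many values on
      the forbidden points.\<close>
    have "finite (\<pi> ` (C \<union> C'))" using C(1) C'(1) by simp
    moreover have "infinite (carrier (G j))"
      using cG[OF j(1)] by (simp add: countable_group_def countably_infinite_def)
    ultimately obtain h where h: "h \<in> carrier (G j)" "h \<notin> \<pi> ` (C \<union> C')"
      by (meson finite_subset subsetI)
    let ?x = "?\<iota> j h"
    have x: "?x \<in> carrier ?P" by (rule \<iota>c[OF j(1) h(1)])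
    have "?x \<noteq> c \<otimes>\<^bsub>?P\<^esub> u" if c: "c \<in> C \<union> C'" and u: "u \<in> O0" for c u
    proof
      assume "?x = c \<otimes>\<^bsub>?P\<^esub> u"
      moreover have cP: "c \<in> carrier ?P" using c C(2) C'(2) by auto
      moreover have "\<pi> u = \<one>\<^bsub>G j\<^esub>" using u \<pi>(3)[OF i0] j(2) by (auto simp: O0_def)
      ultimately have "h = \<pi> c \<otimes>\<^bsub>G j\<^esub> \<one>\<^bsub>G j\<^esub>"
        using \<pi>(2)[OF h(1)] hom_mult[OF \<pi>(1) cP] u O0 by (metis subsetD)
      then show False using h(2) c hom_in_carrier[OF \<pi>(1) cP] by auto
    qed
    then have "avoids C ?x" "avoids C' ?x" by (simp_all add: avoids_def)
    then have "Inr (p \<otimes>\<^bsub>?P\<^esub> ?x) = F p (Inr ?x)" "Inr (q \<otimes>\<^bsub>?P\<^esub> ?x) = F q (Inr ?x)"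
      using C(3)[OF x] C'(3)[OF x] by auto
    moreover have "Inr ?x \<in> Z" using x by (simp add: Z_def)
    ultimately have "p \<otimes>\<^bsub>?P\<^esub> ?x = q \<otimes>\<^bsub>?P\<^esub> ?x" using eq[of "Inr ?x"] by (metis Inr_inject)
    then show ?thesis using p q x by simp
  qed

  let ?\<phi> = "\<lambda>p. restrict (F p) Z"
  have ga: "group_action ?P Z ?\<phi>" by (rule acts_group_action[OF F P.is_group])
  have "transitive_action ?P Z ?\<phi>"
    using ga trans by (auto simp: transitive_action_def transitive_action_axioms_def)
  moreover have "faithful_action ?P Z ?\<phi>"
  proof (intro faithful_action.intro ga faithful_action_axioms.intro inj_onI)
    fix p q assume pq: "p \<in> carrier ?P" "q \<in> carrier ?P" "?\<phi> p = ?\<phi> q"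
    have "F p z = F q z" if "z \<in> Z" for z using fun_cong[OF pq(3), of z] that by simp
    then show "p = q" by (rule faithful[OF pq(1,2)])
  qed
  moreover have "countable_group ?P"
    using free_product_countable_group[OF I _ cG] i0 by auto
  ultimately show ?thesis using amen by (intro class_A_I)
qed

end


section \<open>Factors without property (F)\<close>

text \<open>With more than \<open>k\<close> points in every orbit there are \<open>k + 1\<close> disjoint sets meeting all
  orbits, and one of them has measure at most \<open>1 / (k + 1)\<close>.\<close>

lemma small_transversal:
  assumes K: "group K" and act: "acts K X f" and m: "mean_on X m"
    and large: "\<And>x. x \<in> X \<Longrightarrow> finite (orbit K f x) \<Longrightarrow> k < card (orbit K f x)"
  obtains T where "T \<subseteq> X" "m T \<le> 1 / real (Suc k)"
    "\<And>x. x \<in> X \<Longrightarrow> \<exists>g\<in>carrier K. f g x \<in> T"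
proof -
  have "\<exists>e. inj_on e {..k} \<and> e ` {..k} \<subseteq> orbit K f x" if x: "x \<in> X" for x
  proof -
    obtain B where B: "B \<subseteq> orbit K f x" "finite B" "card B = Suc k"
    proof (cases "finite (orbit K f x)")
      case True
      then show ?thesis using large[OF x True] that obtain_subset_with_card_n[of "Suc k" "orbit K f x"]
        by (metis Suc_leI finite_subset)
    next
      case False
      then show ?thesis using that infinite_arbitrarily_large[of "orbit K f x" "Suc k"] by metis
    qed
    then obtain e where "bij_betw e {..k} B"
      using finite_same_card_bij[of "{..k}" B] by auto
    then show ?thesis using B(1) by (auto simp: bij_betw_def)
  qed
  \<comment> \<open>The enumeration must depend on the orbit only, not on the point in it.\<close>
  then have "\<forall>Q \<in> (orbit K f) ` X. \<exists>e. inj_on e {..k} \<and> e ` {..k} \<subseteq> Q" by blast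
  then obtain e where e: "\<And>x. x \<in> X \<Longrightarrow> inj_on (e (orbit K f x)) {..k}"
    "\<And>x. x \<in> X \<Longrightarrow> e (orbit K f x) ` {..k} \<subseteq> orbit K f x"
    by (metis (no_types, lifting) image_eqI)
  define T where "T l = {e (orbit K f x) l | x. x \<in> X}" for l
  have el: "e (orbit K f x) l \<in> orbit K f x" if "x \<in> X" "l \<le> k" for x l using e(2)[OF that(1)] that(2) by auto
  have TX: "T l \<subseteq> X" if "l \<le> k" for l
    using el[OF _ that] orbit_subset[OF act] by (auto simp: T_def)
  have orb: "orbit K f y = orbit K f x" if "x \<in> X" "y \<in> orbit K f x" for x y
    using that orbit_act[OF act K _ that(1)] by (auto simp: orbit_def[of K f x])
  have "disjoint_family_on T {..k}"
    unfolding disjoint_family_on_def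
  proof (intro ballI impI)
    fix l l' assume l: "l \<in> {..k}" "l' \<in> {..k}" "l \<noteq> l'"
    show "T l \<inter> T l' = {}"
    proof (rule ccontr)
      assume "T l \<inter> T l' \<noteq> {}"
      then obtain x x' where x: "x \<in> X" "x' \<in> X" "e (orbit K f x) l = e (orbit K f x') l'"
        by (auto simp: T_def)
      have "orbit K f x = orbit K f x'"
        using orb[OF x(1) el[OF x(1), of l]] orb[OF x(2) el[OF x(2), of l']] l x(3) by simp
      then show False using x(3) e(1)[OF x(1)] l by (auto dest: inj_onD)
    qed
  qed
  then have "(\<Sum>l\<le>k. m (T l)) = m (\<Union>l\<le>k. T l)"
    using TX by (intro mean_disjoint_Union[OF m, symmetric]) auto
  also have "\<dots> \<le> 1" using TX by (intro mean_le_one[OF m]) auto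
  finally have sum: "(\<Sum>l\<le>k. m (T l)) \<le> 1" .
  have "\<exists>l\<le>k. m (T l) \<le> 1 / real (Suc k)"
  proof (rule ccontr)
    assume "\<not> ?thesis"
    then have "1 / real (Suc k) < m (T l)" if "l \<le> k" for l using that by (meson not_le)
    then have "(\<Sum>l\<le>k. 1 / real (Suc k)) < (\<Sum>l\<le>k. m (T l))"
      by (intro sum_strict_mono) (auto simp del: of_nat_Suc)
    then show False using sum by simp
  qed
  then obtain l where l: "l \<le> k" "m (T l) \<le> 1 / real (Suc k)" by auto
  show thesis
  proof (rule that[OF TX[OF l(1)] l(2)])
    fix x assume x: "x \<in> X"
    obtain g where "g \<in> carrier K" "e (orbit K f x) l = f g x" using el[OF x l(1)] by (auto simp: orbit_def)
    moreover have "e (orbit K f x) l \<in> T l" using x by (auto simp: T_def)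
    ultimately show "\<exists>g\<in>carrier K. f g x \<in> T l" by auto
  qed
qed

lemma inverse_Suc_squeeze:
  fixes a :: "nat \<Rightarrow> real"
  assumes "\<And>k. 0 \<le> a k" "\<And>k. a k \<le> 1 / real (Suc k)"
  shows "a \<longlonglongrightarrow> 0"
proof (rule tendsto_sandwich[OF _ _ tendsto_const])
  show "(\<lambda>k. 1 / real (Suc k)) \<longlonglongrightarrow> 0"
    using LIMSEQ_inverse_real_of_nat by (simp add: inverse_eq_divide)
qed (use assms in auto)

text \<open>The blocks \<open>{a + q L ..< a + q L + d}\<close>, for \<open>q < n\<close>, are disjoint copies of a set with \<open>d\<close>
  elements, and the group acts on each of them and trivially elsewhere.\<close>

lemma acts_on_blocks:
  fixes d L n a N :: nat
  assumes act: "acts K {..<d} \<psi>" and dL: "d \<le> L" and fit: "\<And>q. q < n \<Longrightarrow> a + q * L + d \<le> N"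
  obtains f where "acts K {..<N} f"
    "\<And>g q r. q < n \<Longrightarrow> r < d \<Longrightarrow> f g (a + q * L + r) = a + q * L + \<psi> g r"
    "\<And>g x. x < a \<Longrightarrow> f g x = x"
proof -
  define B where "B = {x. \<exists>q<n. \<exists>r<d. x = a + q * L + r}"
  define f where "f g x = (if x \<in> B then a + (x - a) div L * L + \<psi> g ((x - a) mod L) else x)" for g x
  have f: "f g (a + q * L + r) = a + q * L + \<psi> g r" if "q < n" "r < d" for g q r
  proof -
    have "a + q * L + r \<in> B" using that by (auto simp: B_def)
    moreover have "(a + q * L + r - a) div L = q" "(a + q * L + r - a) mod L = r"
      using that(2) dL by auto
    ultimately show ?thesis by (simp add: f_def)
  qed
  have \<psi>: "\<psi> g r < d" if "g \<in> carrier K" "r < d" for g r using acts_closed[OF act, of g r] that by simp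
  have f': "f g x = x" if "x \<notin> B" for g x using that by (simp add: f_def)
  have "acts K {..<N} f"
  proof (rule actsI)
    fix x assume "x \<in> {..<N}"
    then consider q r where "q < n" "r < d" "x = a + q * L + r" | "x \<notin> B" "x < N"
      by (auto simp: B_def)
    note cs = this
    show "f g x \<in> {..<N}" if "g \<in> carrier K" for g
      using cs
    proof cases
      case (1 q r)
      then show ?thesis using f[OF 1(1,2)] \<psi>[OF that 1(2)] fit[OF 1(1)] by simp
    qed (simp add: f')
    show "f \<one>\<^bsub>K\<^esub> x = x"
      using cs by cases (use f f' acts_one[OF act] in auto)
    show "f (g \<otimes>\<^bsub>K\<^esub> h) x = f g (f h x)" if "g \<in> carrier K" "h \<in> carrier K" for g h
      using cs by cases (use f f' \<psi> acts_mult[OF act] that in auto)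
  qed
  moreover have "f g x = x" if "x < a" for g x using that by (intro f') (auto simp: B_def)
  ultimately show thesis using that f by blast
qed

context
  fixes I :: "'i set" and G :: "'i \<Rightarrow> ('a, 'm) monoid_scheme"
  assumes I: "countable I" and cG: "\<And>i. i \<in> I \<Longrightarrow> countable_group (G i)"
begin

lemma factor_group: "i \<in> I \<Longrightarrow> group (G i)"
  using cG by (simp add: countable_group_def)

text \<open>Only \<open>G j\<close> acts nontrivially on the approximating sets; its orbits there are so large that
  the chosen transversals are asymptotically null.\<close>

lemma class_A_of_not_virtually_F:
  assumes j: "j \<in> I" and i0: "i0 \<in> I" "i0 \<noteq> j" and nVF: "\<not> virtually_F (G j)"
  shows "class_A (free_product I G)"
proof -
  have "\<exists>(X :: nat set) h m T. acts (G j) X h \<and> invariant_mean (G j) X h m \<and> T \<subseteq> X \<and>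
      m T \<le> 1 / real (Suc k) \<and> (\<forall>x\<in>X. \<exists>g\<in>carrier (G j). h g x \<in> T)" for k
  proof -
    have "\<not> small_orbits (G j) k"
      using nVF small_orbits_virtually_F[OF cG[OF j]] by blast
    then obtain X :: "nat set" and h m where X: "acts (G j) X h" "invariant_mean (G j) X h m"
      "\<And>x. x \<in> X \<Longrightarrow> finite (orbit (G j) h x) \<Longrightarrow> k < card (orbit (G j) h x)"
      unfolding small_orbits_def by (metis not_le)
    then obtain T where "T \<subseteq> X" "m T \<le> 1 / real (Suc k)" "\<And>x. x \<in> X \<Longrightarrow> \<exists>g\<in>carrier (G j). h g x \<in> T"
      using small_transversal[OF factor_group[OF j]] by (metis invariant_mean_iff)
    with X(1,2) show ?thesis by blast
  qed
  then obtain X :: "nat \<Rightarrow> nat set" and h m T where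
    X: "\<And>k. acts (G j) (X k) (h k)" "\<And>k. invariant_mean (G j) (X k) (h k) (m k)" "\<And>k. T k \<subseteq> X k"
      "\<And>k. m k (T k) \<le> 1 / real (Suc k)" "\<And>k x. x \<in> X k \<Longrightarrow> \<exists>g\<in>carrier (G j). h k g x \<in> T k"
    by metis
  have mean: "mean_on (X k) (m k)" for k using X(2) by (simp add: invariant_mean_iff)
  define f where "f k i = (if i = j then h k else (\<lambda>g x. x))" for k i
  show ?thesis
  proof (rule free_product_class_A[where ?i0.0 = i0 and j = j and Y = X and T = T and f = f and m = m])
    show "acts (G i) (X k) (f k i)" if "i \<in> I" for k i
      using X(1) by (simp add: f_def acts_trivially)
    show "eventually (\<lambda>k. preserves (G i) (X k) (f k i) (m k)) sequentially" if "i \<in> I" for i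
      using X(2) by (simp add: f_def invariant_mean_iff preserves_def)
    show "X k \<subseteq> R"
      if TR: "T k \<subseteq> R" and R: "R \<subseteq> X k"
        and cl: "\<And>i g y. i \<in> I \<Longrightarrow> g \<in> carrier (G i) \<Longrightarrow> y \<in> R \<Longrightarrow> f k i g y \<in> R" for k R
    proof
      fix x assume x: "x \<in> X k"
      obtain g where g: "g \<in> carrier (G j)" "h k g x \<in> T k" using X(5)[OF x] by blast
      have "h k (inv\<^bsub>G j\<^esub> g) (h k g x) \<in> R"
        using cl[OF j, of "inv\<^bsub>G j\<^esub> g" "h k g x"] g TR group.inv_closed[OF factor_group[OF j]]
        by (auto simp: f_def)
      then show "x \<in> R" using acts_inv(1)[OF X(1) factor_group[OF j] g(1) x] by simp
    qed
    show "(\<lambda>k. m k (T k)) \<longlonglongrightarrow> 0"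
      using X(4) mean_nonneg[OF mean X(3)] by (rule inverse_Suc_squeeze[rotated])
    show "f k i0 g t = t" for k g t using i0(2) by (simp add: f_def)
  qed (use I cG factor_group i0 j mean X(3) in auto)
qed

text \<open>With infinitely many factors each of them may act nontrivially on just one of the sets
  used in the construction, so that invariance under a given factor is only violated once.\<close>

lemma class_A_of_infinite_family:
  assumes inf: "infinite I"
  shows "class_A (free_product I G)"
proof -
  obtain i0 where i0: "i0 \<in> I" using inf by fastforce
  define c where "c = from_nat_into (I - {i0})"
  have c: "bij_betw c UNIV (I - {i0})"
    unfolding c_def using I inf by (intro bij_betw_from_nat_into) auto
  have cI: "c k \<in> I" "c k \<noteq> i0" for k using c by (auto simp: bij_betw_def)
  note grpc = factor_group[OF cI(1)]
  have "\<exists>y. y \<in> carrier (G (c k)) \<and> y \<noteq> \<one>\<^bsub>G (c k)\<^esub>" for k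
  proof -
    have "infinite (carrier (G (c k)))" using cG[OF cI(1)] by (simp add: countable_group_def countably_infinite_def)
    then have "infinite (carrier (G (c k)) - {\<one>\<^bsub>G (c k)\<^esub>})" by simp
    then show ?thesis by (metis DiffD1 DiffD2 ex_in_conv finite.emptyI singletonI)
  qed
  then obtain y where y: "\<And>k. y k \<in> carrier (G (c k))" "\<And>k. y k \<noteq> \<one>\<^bsub>G (c k)\<^esub>" by metis
  define f where "f k i g x = (if i = c k then g \<otimes>\<^bsub>G (c k)\<^esub> x else x)" for k i g x
  define m :: "nat \<Rightarrow> 'a set \<Rightarrow> real" where "m k A = (if y k \<in> A then 1 else 0)" for k A
  show ?thesis
  proof (rule free_product_class_A[where ?i0.0 = i0 and j = "c 0" and f = f and m = m
        and Y = "\<lambda>k. carrier (G (c k))" and T = "\<lambda>k. {\<one>\<^bsub>G (c k)\<^esub>}"])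
    show "acts (G i) (carrier (G (c k))) (f k i)" for k i
    proof (cases "i = c k")
      case True
      then have "f k i = (\<lambda>g x. g \<otimes>\<^bsub>G i\<^esub> x)" by (simp add: f_def fun_eq_iff)
      then show ?thesis using acts_on_itself[OF grpc] True by metis
    qed (simp add: acts_def f_def)
    show "eventually (\<lambda>k. preserves (G i) (carrier (G (c k))) (f k i) (m k)) sequentially" for i
    proof -
      have "eventually (\<lambda>k. i \<noteq> c k) sequentially"
      proof -
        have "finite {k. c k = i}"
          using c by (intro inj_on_finite[of c _ "{i}"]) (auto simp: bij_betw_def inj_on_def)
        then show ?thesis
          unfolding cofinite_eq_sequentially[symmetric] eventually_cofinite by (simp add: eq_commute)
      qed
      then show ?thesis by (rule eventually_mono) (simp add: preserves_def f_def)
    qed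
    show "carrier (G (c k)) \<subseteq> R"
      if "{\<one>\<^bsub>G (c k)\<^esub>} \<subseteq> R"
        and cl: "\<And>i g x. i \<in> I \<Longrightarrow> g \<in> carrier (G i) \<Longrightarrow> x \<in> R \<Longrightarrow> f k i g x \<in> R" for k R
    proof
      fix g assume g: "g \<in> carrier (G (c k))"
      have "g \<otimes>\<^bsub>G (c k)\<^esub> \<one>\<^bsub>G (c k)\<^esub> \<in> R"
        using cl[OF cI(1) g, of "\<one>\<^bsub>G (c k)\<^esub>"] that(1) by (simp add: f_def)
      then show "g \<in> R" using group.is_monoid[OF grpc] g by (simp add: monoid.r_one)
    qed
    show "mean_on (carrier (G (c k))) (m k)" for k using y(1) by (auto simp: mean_on_def m_def)
    show "(\<lambda>k. m k {\<one>\<^bsub>G (c k)\<^esub>}) \<longlonglongrightarrow> 0" using y(2) by (simp add: m_def)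
    show "f k i0 g t = t" for k g t using cI(2)[of k] by (auto simp: f_def)
    show "{\<one>\<^bsub>G (c k)\<^esub>} \<subseteq> carrier (G (c k))" for k
      using monoid.one_closed[OF group.is_monoid[OF grpc]] by simp
  qed (use I cG factor_group i0 cI in auto)
qed

text \<open>Two factors \<open>G j1\<close>, \<open>G j2\<close> acting transitively on finite sets with \<open>d1\<close> and \<open>d2\<close> elements
  act jointly on a long chain of alternating intervals of these lengths, consecutive intervals
  sharing one point.  With \<open>L = d1 + d2 - 2\<close>, the first kind of interval starts at the points
  \<open>q L\<close>, the second at the points \<open>q L + d1 - 1\<close>.\<close>

lemma class_A_of_two_not_F:
  assumes j: "j1 \<in> I" "j2 \<in> I" "j1 \<noteq> j2"
    and VF: "virtually_F (G j1)" "virtually_F (G j2)"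
    and nF: "\<not> property_F (G j1)" "\<not> property_F (G j2)"
  shows "class_A (free_product I G)"
proof -
  obtain d1 :: nat and \<psi>1 where d1: "2 \<le> d1" "acts (G j1) {..<d1} \<psi>1"
    "\<And>x. x < d1 \<Longrightarrow> orbit (G j1) \<psi>1 x = {..<d1}"
    using virtually_F_not_F_finite_action[OF VF(1) nF(1)] by metis
  obtain d2 :: nat and \<psi>2 where d2: "2 \<le> d2" "acts (G j2) {..<d2} \<psi>2"
    "\<And>x. x < d2 \<Longrightarrow> orbit (G j2) \<psi>2 x = {..<d2}"
    using virtually_F_not_F_finite_action[OF VF(2) nF(2)] by metis
  define L where "L = d1 + d2 - 2"
  have L: "d1 \<le> L" "d2 \<le> L" "1 \<le> L" "d1 + d2 = L + 2" using d1(1) d2(1) by (auto simp: L_def)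
  define N where "N k = k * L + d1" for k
  have step: "q * L + L \<le> k * L" if "q < k" for q k :: nat
    using mult_le_mono1[of "Suc q" k L] that by simp
  have "\<exists>f. acts (G j1) {..<N k} f \<and>
      (\<forall>g q r. q < Suc k \<longrightarrow> r < d1 \<longrightarrow> f g (0 + q * L + r) = 0 + q * L + \<psi>1 g r)" for k
  proof (rule acts_on_blocks[OF d1(2) L(1), of "Suc k" 0 "N k"])
    show "0 + q * L + d1 \<le> N k" if "q < Suc k" for q
      using that by (simp add: N_def less_Suc_eq_le mult_le_mono1)
  qed blast
  then obtain f1 where f1: "\<And>k. acts (G j1) {..<N k} (f1 k)"
    "\<And>k g q r. q \<le> k \<Longrightarrow> r < d1 \<Longrightarrow> f1 k g (q * L + r) = q * L + \<psi>1 g r"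
    unfolding add_0 less_Suc_eq_le by metis
  have "\<exists>f. acts (G j2) {..<N k} f \<and>
      (\<forall>g q r. q < k \<longrightarrow> r < d2 \<longrightarrow> f g (d1 - 1 + q * L + r) = d1 - 1 + q * L + \<psi>2 g r) \<and>
      (\<forall>g x. x < d1 - 1 \<longrightarrow> f g x = x)" for k
  proof (rule acts_on_blocks[OF d2(2) L(2), of k "d1 - 1" "N k"])
    show "d1 - 1 + q * L + d2 \<le> N k" if "q < k" for q
      using step[OF that] L(4) d1(1) by (simp add: N_def)
  qed blast
  then obtain f2 where f2: "\<And>k. acts (G j2) {..<N k} (f2 k)"
    "\<And>k g q r. q < k \<Longrightarrow> r < d2 \<Longrightarrow> f2 k g (d1 - 1 + q * L + r) = d1 - 1 + q * L + \<psi>2 g r"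
    "\<And>k g x. x < d1 - 1 \<Longrightarrow> f2 k g x = x"
    by metis
  define f where "f k i = (if i = j1 then f1 k else if i = j2 then f2 k else (\<lambda>g x. x))" for k i
  have act: "acts (G i) {..<N k} (f k i)" for k i
    using f1(1) f2(1) by (simp add: f_def acts_trivially)
  have ne: "finite {..<N k}" "{..<N k} \<noteq> {}" for k using d1(1) by (auto simp: N_def lessThan_empty_iff)
  let ?m = "\<lambda>k (A :: nat set). card A / card {..<N k}"
  show ?thesis
  proof (rule free_product_class_A[where ?i0.0 = j2 and j = j1 and f = f
        and m = ?m and Y = "\<lambda>k. {..<N k}" and T = "\<lambda>k. {0}"])
    show "eventually (\<lambda>k. preserves (G i) {..<N k} (f k i) (?m k)) sequentially" if "i \<in> I" for i
      using uniform_mean_preserved[OF act factor_group[OF that]] by simp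
    show "mean_on {..<N k} (?m k)" for k by (rule uniform_mean[OF ne])
    show "f k j2 g t = t" if "t \<in> {0}" for k g t
      using that f2(3)[of 0 k g] d1(1) j(3) by (simp add: f_def)
    show "(\<lambda>k. ?m k {0}) \<longlonglongrightarrow> 0"
    proof (rule inverse_Suc_squeeze)
      have "k * 1 \<le> k * L" for k by (rule mult_le_mono2[OF L(3)])
      then have "Suc k \<le> N k" for k using d1(1) unfolding N_def by (metis Suc_1 Suc_leD add_mono mult_1_right Suc_eq_plus1)
      then show "?m k {0} \<le> 1 / real (Suc k)" for k
        by (simp add: frac_le del: of_nat_Suc)
    qed simp
    show "{..<N k} \<subseteq> R"
      if R0: "{0} \<subseteq> R"
        and cl: "\<And>i g x. i \<in> I \<Longrightarrow> g \<in> carrier (G i) \<Longrightarrow> x \<in> R \<Longrightarrow> f k i g x \<in> R" for k R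
    proof
      have in1: "q * L + r \<in> R" if start: "q * L \<in> R" and "q \<le> k" "r < d1" for q r
      proof -
        have "r \<in> orbit (G j1) \<psi>1 0" using d1(1) d1(3)[of 0] that(3) by simp
        then obtain g where "g \<in> carrier (G j1)" "r = \<psi>1 g 0" by (auto simp: orbit_def)
        then show ?thesis using cl[OF j(1) _ start] f1(2)[OF that(2), of 0] d1(1) by (force simp: f_def)
      qed
      have in2: "d1 - 1 + q * L + r \<in> R" if start: "d1 - 1 + q * L \<in> R" and "q < k" "r < d2" for q r
      proof -
        have "r \<in> orbit (G j2) \<psi>2 0" using d2(1) d2(3)[of 0] that(3) by simp
        then obtain g where "g \<in> carrier (G j2)" "r = \<psi>2 g 0" by (auto simp: orbit_def)
        then show ?thesis using cl[OF j(2) _ start] f2(2)[OF that(2), of 0] d2(1) j(3) by (force simp: f_def)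
      qed
      have start: "q * L \<in> R" if "q \<le> k" for q
        using that
      proof (induction q)
        case 0
        then show ?case using R0 by simp
      next
        case (Suc q)
        have "q * L + (d1 - 1) \<in> R" using Suc d1(1) by (intro in1) auto
        then have "d1 - 1 + q * L + (d2 - 1) \<in> R" using Suc d2(1) by (intro in2) (auto simp: add.commute)
        moreover have "d1 - 1 + q * L + (d2 - 1) = Suc q * L" using L(4) d1(1) d2(1) by simp
        ultimately show ?case by metis
      qed
      fix x assume "x \<in> {..<N k}"
      then have x: "x < k * L + d1" by (simp add: N_def)
      define q r where "q = x div L" and "r = x mod L"
      have xqr: "x = q * L + r" and r: "r < L" using L(3) by (auto simp: q_def r_def)
      have q: "q \<le> k"
      proof (rule ccontr)
        assume "\<not> q \<le> k"
        then show False using step[of k q] xqr x L(1) by simp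
      qed
      show "x \<in> R"
      proof (cases "r < d1")
        case True
        then show ?thesis using in1[OF start[OF q] q] xqr by simp
      next
        case False
        then have "q < k" using q x xqr by (cases "q = k") auto
        moreover have "d1 - 1 + q * L \<in> R"
          using in1[OF start[OF q] q, of "d1 - 1"] d1(1) by (simp add: add.commute)
        moreover have "r - (d1 - 1) < d2" using r L(4) d1(1) False by linarith
        ultimately have "d1 - 1 + q * L + (r - (d1 - 1)) \<in> R" by (intro in2)
        moreover have "d1 - 1 + q * L + (r - (d1 - 1)) = x" using False xqr by simp
        ultimately show ?thesis by simp
      qed
    qed
  qed (use I cG factor_group j act d1(1) in \<open>auto simp: N_def\<close>)
qed

end

section \<open>The dichotomy\<close>

theorem corollary1p6:
  fixes n :: enat
    and G :: "nat \<Rightarrow> ('a, 'm) monoid_scheme"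
    and I :: "nat set"
  defines "I \<equiv> {i. 1 \<le> i \<and> enat i \<le> n}"
  assumes "2 \<le> n"
    and "\<And>i. i \<in> I \<Longrightarrow> countable_group (G i)"
  shows "(class_A (free_product I G) \<or> virtually_F (free_product I G)) \<and>
         \<not> (class_A (free_product I G) \<and> virtually_F (free_product I G)) \<and>
         (virtually_F (free_product I G) \<longleftrightarrow>
            n \<noteq> \<infinity> \<and>
            (\<exists>\<sigma>. bij_betw \<sigma> I I \<and>
                 (\<forall>i\<in>I. i > 1 \<longrightarrow> property_F (G (\<sigma> i))) \<and>
                 virtually_F (G (\<sigma> 1))))"
proof -
  let ?P = "free_product I G"
  let ?cond = "n \<noteq> \<infinity> \<and> (\<exists>\<sigma>. bij_betw \<sigma> I I \<and>
    (\<forall>i\<in>I. i > 1 \<longrightarrow> property_F (G (\<sigma> i))) \<and> virtually_F (G (\<sigma> 1)))"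
  note cG = assms(3)
  have grp: "group (G i)" if "i \<in> I" for i using cG[OF that] by (simp add: countable_group_def)
  have I: "countable I" by simp
  have "1 \<le> n" using assms(2) by (rule order_trans[rotated]) simp
  then have one_two: "1 \<in> I" "2 \<in> I" using assms(2) by (auto simp: I_def one_enat_def numeral_eq_enat)
  have VF: "virtually_F ?P" if cond: ?cond
  proof -
    obtain \<sigma> where \<sigma>: "bij_betw \<sigma> I I" "\<forall>i\<in>I. i > 1 \<longrightarrow> property_F (G (\<sigma> i))" "virtually_F (G (\<sigma> 1))"
      using cond by blast
    obtain l where "n = enat l" using cond by auto
    then have "I \<subseteq> {..l}" by (auto simp: I_def)
    then have "finite I" by (rule finite_subset) simp
    moreover have "property_F (G i)" if i: "i \<in> I" "i \<noteq> \<sigma> 1" for i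
    proof -
      obtain k where k: "k \<in> I" "i = \<sigma> k" using i(1) \<sigma>(1) by (auto simp: bij_betw_def)
      then have "k > 1" using i(2) by (cases "k = 1") (auto simp: I_def)
      then show ?thesis using \<sigma>(2) k by simp
    qed
    ultimately show ?thesis
      using \<sigma>(1,3) one_two(1) by (intro free_product_virtually_F[OF grp, of I _ "\<sigma> 1"]) (auto simp: bij_betw_def)
  qed
  have A: "class_A ?P" if ncond: "\<not> ?cond"
  proof (cases "n = \<infinity>")
    case True
    then have "I = {1..}" by (auto simp: I_def)
    then have "infinite I" by (simp add: infinite_Ici)
    then show ?thesis using I cG by (intro class_A_of_infinite_family)
  next
    case False
    show ?thesis
    proof (cases "\<forall>i\<in>I. virtually_F (G i)")
      case all: True
      have "\<exists>j1\<in>I. \<exists>j2\<in>I. j1 \<noteq> j2 \<and> \<not> property_F (G j1) \<and> \<not> property_F (G j2)"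
      proof (rule ccontr)
        assume "\<not> ?thesis"
        then have "\<exists>j\<in>I. \<forall>i\<in>I. i \<noteq> j \<longrightarrow> property_F (G i)" using one_two(1) by metis
        then obtain j where j: "j \<in> I" "\<And>i. i \<in> I \<Longrightarrow> i \<noteq> j \<Longrightarrow> property_F (G i)" by blast
        define \<sigma> where "\<sigma> = Transposition.transpose 1 j"
        have "bij_betw \<sigma> I I"
          using j(1) one_two(1) by (simp add: \<sigma>_def)
        moreover have "\<sigma> 1 = j" by (simp add: \<sigma>_def)
        moreover have "property_F (G (\<sigma> i))" if "i \<in> I" "i > 1" for i
        proof (rule j(2))
          show "\<sigma> i \<in> I" using \<open>bij_betw \<sigma> I I\<close> that(1) by (auto simp: bij_betw_def)
          show "\<sigma> i \<noteq> j" using that(2) by (auto simp: \<sigma>_def Transposition.transpose_def)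
        qed
        ultimately show False using ncond all j(1) False by blast
      qed
      then show ?thesis using class_A_of_two_not_F[of I G] I cG all by blast
    next
      case False
      then obtain j where j: "j \<in> I" "\<not> virtually_F (G j)" by blast
      obtain i0 where "i0 \<in> I" "i0 \<noteq> j" using one_two by (cases "j = 1") auto
      then show ?thesis using class_A_of_not_virtually_F[of I G j i0] I cG j by blast
    qed
  qed
  show ?thesis using VF A class_A_not_virtually_F by blast
qed

end
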